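(* Let $p\in[2,\infty)$. There exists a constant $C\in(0,\infty)$, depending only on $a,b,d,\varrho,K,L$ and $p$, such that for all integers $n\ge\lfloor b-a\rfloor+1$, all $\delta\in[0,1]$, all $(\eta,f)\in F^{\varrho}$ and all $(\tilde\eta,\tilde f)\in V_{(\eta,f)}(\delta)$ we have $$\Bigl\|\sup_{a\le t\le b}\|z(\eta,f)(t)-\bar l(\tilde\eta,\tilde f,\delta)(t)\|\Bigr\|_p\le C\bigl(h^{\varrho+1/2}+\delta\bigr),\qquad h=\frac{b-a}{n},$$ where $z(\eta,f)$ is the solution of $z'(t)=f(t,z(t))$, $t\in[a,b]$, $z(a)=\eta$, and $\bar l(\tilde\eta,\tilde f,\delta)$ is the randomized two-stage Runge-Kutta approximation with $n$ steps based on the noisy data $(\tilde\eta,\tilde f)$.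
   Context: Setting: $-\infty<a<b<\infty$, $d\in\mathbb{N}$, $K,L\in(0,\infty)$, $\varrho\in(0,1]$. On $\mathbb{R}^d$, $\|x\|=\sum_{k=1}^d|x_k|$, and $B(x,r)=\{y\in\mathbb{R}^d:\|y-x\|\le r\}$. $(\Omega,\Sigma,\mathbb{P})$ is a complete probability space; for a real random variable $X$, $\|X\|_p=(\mathbb{E}|X|^p)^{1/p}$. Put $$\bar R=\max\Bigl\{K(1+b-a)\bigl(1+e^{K(b-a)}(1+K(b-a))\bigr),\ K+(b-a)(1+K)+\bigl(\tfrac1K+1\bigr)(1+K(b-a))\bigl(e^{K(b-a)(1+K(b-a))}(1+K)-1\bigr)\Bigr\}.$$ The class $F^{\varrho}=F^{\varrho}(K,L)$ consists of all pairs $(\eta,f)$ with $\eta\in\mathbb{R}^d$, $f:[a,b]\times\mathbb{R}^d\to\mathbb{R}^d$ such that: $\|\eta\|\le K$; $f$ is continuous on $[a,b]\times\mathbb{R}^d$; $\|f(t,x)\|\le K(1+\|x\|)$ for all $(t,x)\in[a,b]\times\mathbb{R}^d$; $\|f(t,x)-f(s,x)\|\le L|t-s|^{\varrho}$ for all $t,s\in[a,b]$, $x\in B(\eta,\bar R)$; $\|f(t,x)-f(t,y)\|\le L\|x-y\|$ for all $t\in[a,b]$, $x,y\in B(\eta,\bar R)$. For $(\eta,f)\in F^{\varrho}$ the initial value problem $z'=f(t,z)$, $z(a)=\eta$ has a unique solution on $[a,b]$, denoted $z(\eta,f)$. Noisy data: for $\delta\in[0,1]$, $V_{(\eta,f)}(\delta)$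 is the set of pairs $(\tilde\eta,\tilde f)$ with $\tilde\eta\in B(\eta,\delta)$ and $\tilde f=f+\tilde\delta_f$, where $\tilde\delta_f:[a,b]\times\mathbb{R}^d\to\mathbb{R}^d$ is Borel measurable and $\|\tilde\delta_f(t,y)\|\le\delta$ for all $(t,y)$. Randomized two-stage Runge-Kutta algorithm: let $n\in\mathbb{N}$, $h=(b-a)/n$, $t_j=a+jh$ for $j=0,\dots,n$, and let $(\tau_j)_{j\in\mathbb{N}}$ be i.i.d. random variables on $(\Omega,\Sigma,\mathbb{P})$ uniformly distributed on $[0,1]$. Put $\theta_j=t_{j-1}+\tau_jh$, $\bar V^0=\tilde\eta$ and, for $j=1,\dots,n$, $$\bar V^j_\tau=\bar V^{j-1}+h\tau_j\tilde f(t_{j-1},\bar V^{j-1}),\qquad \bar V^j=\bar V^{j-1}+h\tilde f(\theta_j,\bar V^j_\tau).$$ Then $\bar l=\bar l(\tilde\eta,\tilde f,\delta):[a,b]\to\mathbb{R}^d$ is the piecewise linear interpolation: $\bar l(t)=\frac{\bar V^{j+1}-\bar V^j}{t_{j+1}-t_j}(t-t_j)+\bar V^j$ for $t\in[t_j,t_{j+1}]$, $j=0,\dots,n-1$. *)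

theory Defs
  imports "HOL-Probability.Probability"
begin

definition l1norm :: "real ^ 'd \<Rightarrow> real" where
  "l1norm x = (\<Sum>k\<in>UNIV. \<bar>x $ k\<bar>)"

definition l1ball :: "real ^ 'd \<Rightarrow> real \<Rightarrow> (real ^ 'd) set" where
  "l1ball x r = {y. l1norm (y - x) \<le> r}"

definition Rbar :: "real \<Rightarrow> real \<Rightarrow> real \<Rightarrow> real" where
  "Rbar a b K = max
     (K * (1 + b - a) * (1 + exp (K * (b - a)) * (1 + K * (b - a))))
     (K + (b - a) * (1 + K)
        + (1 / K + 1) * (1 + K * (b - a)) * (exp (K * (b - a) * (1 + K * (b - a))) * (1 + K) - 1))"

text \<open>A right-hand side on \<open>[a,b] \<times> \<real>\<^sup>d\<close> is a total function of type
  \<open>real \<Rightarrow> real ^ 'd \<Rightarrow> real ^ 'd\<close>; nothing is required of its values at times outside \<open>[a,b]\<close>.\<close>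

definition Fclass ::
    "real \<Rightarrow> real \<Rightarrow> real \<Rightarrow> real \<Rightarrow> real
      \<Rightarrow> ((real ^ 'd) \<times> (real \<Rightarrow> real ^ 'd \<Rightarrow> real ^ 'd)) set" where
  "Fclass a b \<rho> K L = {(\<eta>, f).
     l1norm \<eta> \<le> K \<and>
     continuous_on ({a..b} \<times> UNIV) (\<lambda>(t, x). f t x) \<and>
     (\<forall>t\<in>{a..b}. \<forall>x. l1norm (f t x) \<le> K * (1 + l1norm x)) \<and>
     (\<forall>t\<in>{a..b}. \<forall>s\<in>{a..b}. \<forall>x\<in>l1ball \<eta> (Rbar a b K).
        l1norm (f t x - f s x) \<le> L * \<bar>t - s\<bar> powr \<rho>) \<and>
     (\<forall>t\<in>{a..b}. \<forall>x\<in>l1ball \<eta> (Rbar a b K). \<forall>y\<in>l1ball \<eta> (Rbar a b K).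
        l1norm (f t x - f t y) \<le> L * l1norm (x - y))}"

text \<open>At the end points the derivative is one-sided.\<close>

definition solves_ivp ::
    "real \<Rightarrow> real \<Rightarrow> real ^ 'd \<Rightarrow> (real \<Rightarrow> real ^ 'd \<Rightarrow> real ^ 'd) \<Rightarrow> (real \<Rightarrow> real ^ 'd) \<Rightarrow> bool" where
  "solves_ivp a b \<eta> f z \<longleftrightarrow>
     z a = \<eta> \<and> (\<forall>t\<in>{a..b}. (z has_vector_derivative f t (z t)) (at t within {a..b}))"

definition noisy_data ::
    "real \<Rightarrow> real \<Rightarrow> real ^ 'd \<Rightarrow> (real \<Rightarrow> real ^ 'd \<Rightarrow> real ^ 'd) \<Rightarrow> real
      \<Rightarrow> ((real ^ 'd) \<times> (real \<Rightarrow> real ^ 'd \<Rightarrow> real ^ 'd)) set" where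
  "noisy_data a b \<eta> f \<delta> = {(\<eta>', f').
     \<eta>' \<in> l1ball \<eta> \<delta> \<and>
     (\<exists>df. (\<lambda>(t, y). df t y) \<in> borel_measurable (restrict_space borel ({a..b} \<times> UNIV)) \<and>
           (\<forall>t\<in>{a..b}. \<forall>y. l1norm (df t y) \<le> \<delta>) \<and>
           (\<forall>t\<in>{a..b}. \<forall>y. f' t y = f t y + df t y))}"

definition iid_uniform01 :: "'w measure \<Rightarrow> (nat \<Rightarrow> 'w \<Rightarrow> real) \<Rightarrow> bool" where
  "iid_uniform01 M \<tau> \<longleftrightarrow>
     prob_space.indep_vars M (\<lambda>_. borel) \<tau> {1..} \<and>
     (\<forall>j\<ge>1. distr M borel (\<tau> j) = uniform_measure lborel {0..1})"

definition node :: "real \<Rightarrow> real \<Rightarrow> nat \<Rightarrow> nat \<Rightarrow> real" where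
  "node a b n j = a + real j * ((b - a) / real n)"

text \<open>The scheme for one realisation \<open>s\<close> of the sequence of random variables (used from index 1 on).\<close>

fun rk2 ::
    "real \<Rightarrow> real \<Rightarrow> nat \<Rightarrow> real ^ 'd \<Rightarrow> (real \<Rightarrow> real ^ 'd \<Rightarrow> real ^ 'd) \<Rightarrow> (nat \<Rightarrow> real)
      \<Rightarrow> nat \<Rightarrow> real ^ 'd" where
  "rk2 a b n \<eta> f s 0 = \<eta>"
| "rk2 a b n \<eta> f s (Suc j) =
     (let h = (b - a) / real n;
          V = rk2 a b n \<eta> f s j;
          \<theta> = node a b n j + s (Suc j) * h;
          W = V + (h * s (Suc j)) *\<^sub>R f (node a b n j) V
      in V + h *\<^sub>R f \<theta> W)"

text \<open>At an interior node the least \<open>j\<close> selects the interval to the left of the node; both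
  neighbouring pieces agree there, see \<open>rk2_interp_on_piece\<close>.\<close>

definition rk2_interp ::
    "real \<Rightarrow> real \<Rightarrow> nat \<Rightarrow> real ^ 'd \<Rightarrow> (real \<Rightarrow> real ^ 'd \<Rightarrow> real ^ 'd) \<Rightarrow> (nat \<Rightarrow> real)
      \<Rightarrow> real \<Rightarrow> real ^ 'd" where
  "rk2_interp a b n \<eta> f s t =
     (let j = (LEAST j. t \<le> node a b n (Suc j)) in
      ((t - node a b n j) / (node a b n (Suc j) - node a b n j)) *\<^sub>R
        (rk2 a b n \<eta> f s (Suc j) - rk2 a b n \<eta> f s j) + rk2 a b n \<eta> f s j)"

lemma rk2_interp_on_piece:
  assumes "a < b" "0 < n" "t \<in> {node a b n j..node a b n (Suc j)}"
  shows "rk2_interp a b n \<eta> f s t =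
    ((t - node a b n j) / (node a b n (Suc j) - node a b n j)) *\<^sub>R
      (rk2 a b n \<eta> f s (Suc j) - rk2 a b n \<eta> f s j) + rk2 a b n \<eta> f s j"
proof -
  define h where "h = (b - a) / real n"
  have h: "h > 0" using assms by (simp add: h_def)
  have nd: "node a b n i = a + real i * h" for i by (simp add: node_def h_def)
  have mono: "node a b n i < node a b n k \<longleftrightarrow> i < k" for i k using h by (simp add: nd)
  show ?thesis
  proof (cases "0 < j \<and> t = node a b n j")
    case True
    then obtain i where i: "j = Suc i" by (cases j) auto
    have "(LEAST k. t \<le> node a b n (Suc k)) = i"
    proof (rule Least_equality)
      show "t \<le> node a b n (Suc i)" using True i by simp
      fix k assume "t \<le> node a b n (Suc k)"
      then have "\<not> node a b n (Suc k) < node a b n j" using True by simp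
      then show "i \<le> k" unfolding mono i by simp
    qed
    moreover have "node a b n (Suc i) - node a b n i = h" by (simp add: nd algebra_simps)
    ultimately show ?thesis using True h unfolding rk2_interp_def Let_def
      by (simp add: i del: rk2.simps)
  next
    case False
    have "(LEAST k. t \<le> node a b n (Suc k)) = j"
    proof (rule Least_equality)
      show "t \<le> node a b n (Suc j)" using assms by simp
      fix k assume k: "t \<le> node a b n (Suc k)"
      show "j \<le> k"
      proof (rule ccontr)
        assume "\<not> j \<le> k"
        then have "Suc k \<le> j" by simp
        then have "\<not> node a b n j < node a b n (Suc k)" unfolding mono by simp
        with k assms False \<open>\<not> j \<le> k\<close> show False by auto
      qed
    qed
    then show ?thesis unfolding rk2_interp_def Let_def by (simp del: rk2.simps)
  qed
qed

text \<open>Meaningful only for measurable \<open>X\<close> with integrable \<open>\<bar>X\<bar>\<^sup>p\<close> (otherwise the Bochner integral is \<open>0\<close>),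
  so a bound on it has to be stated together with these two properties.\<close>

definition Lp_norm :: "'w measure \<Rightarrow> real \<Rightarrow> ('w \<Rightarrow> real) \<Rightarrow> real" where
  "Lp_norm M p X = (\<integral>\<omega>. \<bar>X \<omega>\<bar> powr p \<partial>M) powr (1 / p)"

definition sup_error ::
    "real \<Rightarrow> real \<Rightarrow> (real \<Rightarrow> real ^ 'd) \<Rightarrow> (real \<Rightarrow> real ^ 'd) \<Rightarrow> real" where
  "sup_error a b z l = (SUP t\<in>{a..b}. l1norm (z t - l t))"

end

theory Submission
  imports Defs
begin

text \<open>
  Write \<open>e\<^sub>j = z(t\<^sub>j) - V\<^sup>j\<close> for the error at the nodes. Subtracting the scheme from the integrated
  differential equation gives \<open>e\<^sub>j\<^sub>+\<^sub>1 = e\<^sub>j + D\<^sub>j + r\<^sub>j\<close>. Here \<open>D\<^sub>j = z(t\<^sub>j\<^sub>+\<^sub>1) - z(t\<^sub>j) - h z'(\<theta>\<^sub>j\<^sub>+\<^sub>1)\<close> is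
  the error of integrating \<open>z'\<close> over one step by a single random evaluation, and the Lipschitz condition
  bounds the remainder by \<open>O(h)(|e\<^sub>j| + h\<^sup>1\<^sup>+\<^sup>\<rho> + \<delta>)\<close>: the stage of the scheme is an Euler
  step and approximates \<open>z(\<theta>\<^sub>j\<^sub>+\<^sub>1)\<close> up to \<open>|e\<^sub>j| + O(h\<^sup>1\<^sup>+\<^sup>\<rho> + h\<delta>)\<close>. By the discrete Gronwall
  inequality, \<open>max |e\<^sub>j|\<close> is at most a constant times \<open>\<delta> + h\<^sup>1\<^sup>+\<^sup>\<rho> + max |D\<^sub>0 + \<dots> + D\<^sub>j|\<close>
  (lemma \<open>err_bound\<close>).

  Since \<open>z'\<close> is Hoelder continuous with exponent \<open>\<rho>\<close>, every \<open>D\<^sub>j\<close> is of size \<open>h\<^sup>1\<^sup>+\<^sup>\<rho>\<close>. Adding up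
  \<open>n = O(1/h)\<close> of these sizes would yield only \<open>h\<^sup>\<rho>\<close>. But \<open>\<theta>\<^sub>j\<^sub>+\<^sub>1\<close> is uniform on the step, so the \<open>D\<^sub>j\<close>
  are centred, and they are independent; their partial sums are therefore of size
  \<open>\<surd>n h\<^sup>1\<^sup>+\<^sup>\<rho> = O(h\<^sup>\<rho>\<^sup>+\<^sup>1\<^sup>/\<^sup>2)\<close>. This is made precise through exponential moments: a pathwise form of
  Doob's \<open>L\<^sup>2\<close> inequality, applied to the exponentials of the partial sums, reduces their maximum to the
  last sum, to which Hoeffding's lemma applies (lemma \<open>exp_maximal_inequality\<close>). An exponential moment
  controls the \<open>p\<close>-th moments for all \<open>p\<close> at once.

  Two side conditions have to be dealt with. The Lipschitz and Hoelder conditions hold only in the ball of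
  radius \<open>Rbar\<close> around \<open>\<eta>\<close>; a-priori growth bounds show that neither the solution nor any
  value or stage of the noisy scheme leaves it. And the perturbed right-hand side is arbitrary outside
  \<open>[a,b]\<close>; almost surely the scheme never looks there, so its error agrees with a measurable
  function outside a null set, which suffices as the probability space is complete.
\<close>

section \<open>The sum norm\<close>

definition sgn_vec :: "real ^ 'd \<Rightarrow> real ^ 'd" where
  "sgn_vec x = (\<chi> k. sgn (x $ k))"

lemma l1norm_eq_inner: "l1norm x = x \<bullet> sgn_vec x"
  by (simp add: l1norm_def sgn_vec_def inner_vec_def abs_sgn)

lemma inner_sgn_vec_le: "x \<bullet> sgn_vec y \<le> l1norm x"
  unfolding l1norm_def sgn_vec_def inner_vec_def
  by (intro sum_mono) (auto simp: sgn_real_def)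

lemma l1norm_zero [simp]: "l1norm 0 = 0"
  by (simp add: l1norm_def)

lemma l1norm_nonneg [simp]: "0 \<le> l1norm x"
  by (simp add: l1norm_def sum_nonneg)

lemma l1norm_triangle: "l1norm (x + y) \<le> l1norm x + l1norm y"
  by (simp add: l1norm_def flip: sum.distrib) (intro sum_mono abs_triangle_ineq)

lemma l1norm_minus [simp]: "l1norm (- x) = l1norm x"
  by (simp add: l1norm_def)

lemma l1norm_commute: "l1norm (x - y) = l1norm (y - x)"
  by (simp add: l1norm_def abs_minus_commute)

lemma l1norm_diff: "l1norm (x - y) \<le> l1norm x + l1norm y"
  using l1norm_triangle[of x "- y"] by simp

lemma l1norm_scaleR: "l1norm (c *\<^sub>R x) = \<bar>c\<bar> * l1norm x"
  by (simp add: l1norm_def abs_mult sum_distrib_left)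

lemma l1norm_sum: "l1norm (\<Sum>i\<in>A. f i) \<le> (\<Sum>i\<in>A. l1norm (f i))"
proof (induction A rule: infinite_finite_induct)
  case (insert x F)
  then show ?case using l1norm_triangle[of "f x" "sum f F"] by simp
qed auto

lemma component_le_l1norm: "\<bar>x $ k\<bar> \<le> l1norm x"
  unfolding l1norm_def by (rule member_le_sum) auto

lemma continuous_on_l1norm [continuous_intros]:
  "continuous_on S g \<Longrightarrow> continuous_on S (\<lambda>x. l1norm (g x))"
  unfolding l1norm_def by (intro continuous_intros)

lemma borel_measurable_l1norm [measurable]: "l1norm \<in> borel_measurable borel"
  by (intro borel_measurable_continuous_onI continuous_intros)

text \<open>Testing with the sign vector of \<open>z t - z s\<close> reduces the claim to the scalar mean value theorem with no
  loss of constants. A componentwise argument would lose a factor equal to the dimension, whereas the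
  radius \<open>Rbar\<close> is independent of the dimension.\<close>

lemma l1norm_mean_value:
  fixes z z' :: "real \<Rightarrow> real ^ 'd" and \<phi> \<phi>' :: "real \<Rightarrow> real"
  assumes "s \<le> t"
    and z: "\<And>r. r \<in> {s..t} \<Longrightarrow> (z has_vector_derivative z' r) (at r within {s..t})"
    and \<phi>: "\<And>r. r \<in> {s..t} \<Longrightarrow> (\<phi> has_real_derivative \<phi>' r) (at r within {s..t})"
    and le: "\<And>r. r \<in> {s..t} \<Longrightarrow> l1norm (z' r) \<le> \<phi>' r"
  shows "l1norm (z t - z s) \<le> \<phi> t - \<phi> s"
proof -
  define \<sigma> where "\<sigma> = sgn_vec (z t - z s)"
  define g where "g r = z r \<bullet> \<sigma> - \<phi> r" for r
  have "(g has_derivative (\<lambda>y. y * (z' r \<bullet> \<sigma> - \<phi>' r))) (at r within {s..t})" if "s \<le> r" "r \<le> t" for r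
  proof -
    have r: "r \<in> {s..t}" using that by simp
    show ?thesis unfolding g_def
      using z[OF r, unfolded has_vector_derivative_def] \<phi>[OF r, unfolded has_field_derivative_def]
      by (auto intro!: derivative_eq_intros simp: algebra_simps)
  qed
  from mvt_very_simple[OF assms(1) this]
  obtain r where r: "r \<in> {s..t}" "g t - g s = (t - s) * (z' r \<bullet> \<sigma> - \<phi>' r)" by auto
  have "z' r \<bullet> \<sigma> \<le> \<phi>' r" using inner_sgn_vec_le le[OF r(1)] order_trans unfolding \<sigma>_def by blast
  with r assms(1) have "g t - g s \<le> 0" by (simp add: mult_nonneg_nonpos)
  moreover have "l1norm (z t - z s) = z t \<bullet> \<sigma> - z s \<bullet> \<sigma>"
    by (simp add: l1norm_eq_inner \<sigma>_def inner_diff_left)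
  ultimately show ?thesis by (simp add: g_def)
qed

section \<open>A-priori bounds\<close>

text \<open>A form of Gronwall's lemma that needs no integrals: take the smallest constant \<open>C\<close> with
  \<open>1 + l1norm (z t) \<le> C * exp (K * (t - a))\<close> on \<open>[a,b]\<close> and compare at a point where equality holds.\<close>

lemma solves_ivp_growth:
  fixes f :: "real \<Rightarrow> real ^ 'd \<Rightarrow> real ^ 'd"
  assumes z: "solves_ivp a b \<eta> f z" and "0 < K" and "l1norm \<eta> \<le> K"
    and f: "\<And>t x. t \<in> {a..b} \<Longrightarrow> l1norm (f t x) \<le> K * (1 + l1norm x)"
    and t: "t \<in> {a..b}"
  shows "1 + l1norm (z t) \<le> (1 + K) * exp (K * (t - a))"
proof -
  have za: "z a = \<eta>" and
    dz: "\<And>t. t \<in> {a..b} \<Longrightarrow> (z has_vector_derivative f t (z t)) (at t within {a..b})"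
    using z by (auto simp: solves_ivp_def)
  have cz: "continuous_on {a..b} z"
    by (auto simp: continuous_on_eq_continuous_within intro: has_vector_derivative_continuous dz)
  define w where "w r = (1 + l1norm (z r)) * exp (- K * (r - a))" for r
  have "continuous_on {a..b} w" unfolding w_def by (intro continuous_intros cz)
  moreover have "{a..b} \<noteq> {}" using t by auto
  ultimately obtain m where m: "m \<in> {a..b}" "\<And>r. r \<in> {a..b} \<Longrightarrow> w r \<le> w m"
    using continuous_attains_sup[of "{a..b}" w] by auto
  have bd: "1 + l1norm (z r) \<le> w m * exp (K * (r - a))" if "r \<in> {a..b}" for r
  proof -
    have "1 + l1norm (z r) = w r * exp (K * (r - a))" by (simp add: w_def exp_minus)
    also have "\<dots> \<le> w m * exp (K * (r - a))" using m(2)[OF that] by (intro mult_right_mono) auto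
    finally show ?thesis .
  qed
  \<comment> \<open>Integrating the bound on \<open>z'\<close> up to the maximum point gives back the extremal bound itself,
    and the common term cancels.\<close>
  have "l1norm (z m - z a) \<le> w m * exp (K * (m - a)) - w m * exp (K * (a - a))"
  proof (rule l1norm_mean_value[where z' = "\<lambda>r. f r (z r)" and \<phi>' = "\<lambda>r. K * (w m * exp (K * (r - a)))"])
    fix r assume r: "r \<in> {a..m}"
    then have r': "r \<in> {a..b}" using m by auto
    show "(z has_vector_derivative f r (z r)) (at r within {a..m})"
      using dz[OF r'] by (rule has_vector_derivative_within_subset) (use m in auto)
    show "((\<lambda>r. w m * exp (K * (r - a))) has_real_derivative K * (w m * exp (K * (r - a))))
        (at r within {a..m})"
      by (auto intro!: derivative_eq_intros)
    show "l1norm (f r (z r)) \<le> K * (w m * exp (K * (r - a)))"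
      using f[OF r', of "z r"] mult_left_mono[OF bd[OF r'], of K] \<open>0 < K\<close> by linarith
  qed (use m in auto)
  moreover have "1 + l1norm (z m) = w m * exp (K * (m - a))" by (simp add: w_def exp_minus)
  moreover have "l1norm (z m) \<le> l1norm (z m - z a) + l1norm \<eta>"
    using l1norm_triangle[of "z m - z a" "z a"] za by simp
  ultimately have "w m \<le> 1 + K" using assms(3) by simp
  then have "w m * exp (K * (t - a)) \<le> (1 + K) * exp (K * (t - a))" by (intro mult_right_mono) auto
  with bd[OF t] show ?thesis by linarith
qed

text \<open>The second entry of the maximum in \<open>Rbar\<close> is exactly \<open>K\<close> plus the bound that the growth estimates below
  give for the stages of the scheme; the present form is the one in which those estimates arise.\<close>

lemma Rbar_ge:
  assumes "a < b" "0 < K"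
  shows "K + ((1 + K) * exp (K * (b - a) * (1 + K * (b - a))) * (1 / K + 1) * (1 + K * (b - a)) - (1 / K + 1))
    \<le> Rbar a b K"
proof -
  define E where "E = exp (K * (b - a) * (1 + K * (b - a)))"
  define T where "T = b - a"
  have "K + ((1 + K) * E * (1 / K + 1) * (1 + K * T) - (1 / K + 1))
    = K + T * (1 + K) + (1 / K + 1) * (1 + K * T) * (E * (1 + K) - 1)"
    using assms by (simp add: field_simps)
  then show ?thesis unfolding Rbar_def E_def T_def by simp
qed

lemma in_l1ball_RbarI:
  assumes "a < b" "0 < K" "l1norm \<eta> \<le> K"
    and "l1norm x + (1 / K + 1)
      \<le> (1 + K) * exp (K * (b - a) * (1 + K * (b - a))) * (1 / K + 1) * (1 + K * (b - a))"
  shows "x \<in> l1ball \<eta> (Rbar a b K)"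
  using Rbar_ge[OF assms(1,2)] l1norm_diff[of x \<eta>] assms(3,4) unfolding l1ball_def by simp

lemma solution_in_l1ball:
  fixes f :: "real \<Rightarrow> real ^ 'd \<Rightarrow> real ^ 'd"
  assumes "a < b" and z: "solves_ivp a b \<eta> f z" and "0 < K" and "l1norm \<eta> \<le> K"
    and f: "\<And>t x. t \<in> {a..b} \<Longrightarrow> l1norm (f t x) \<le> K * (1 + l1norm x)"
    and t: "t \<in> {a..b}"
  shows "z t \<in> l1ball \<eta> (Rbar a b K)"
proof (rule in_l1ball_RbarI)
  define T where "T = b - a"
  define E where "E = exp (K * T * (1 + K * T))"
  have T: "T > 0" using assms by (simp add: T_def)
  have KT: "K * T > 0" using T assms by simp
  have "K * (t - a) \<le> K * T" using t assms by (simp add: T_def)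
  also have "\<dots> \<le> K * T * (1 + K * T)" using KT by (simp add: mult_le_cancel_left1)
  finally have "exp (K * (t - a)) \<le> E" by (simp add: E_def)
  then have "(1 + K) * exp (K * (t - a)) \<le> (1 + K) * E" using assms by (intro mult_left_mono) auto
  with solves_ivp_growth[OF z assms(3,4) f t] have "1 + l1norm (z t) \<le> (1 + K) * E" by auto
  moreover have "1 \<le> (1 + K) * E"
    using mult_mono[of 1 "1 + K" 1 E] KT assms by (simp add: E_def)
  then have "1 / K \<le> 1 / K * ((1 + K) * E)" using assms by (simp add: field_simps)
  ultimately have "l1norm (z t) + (1 / K + 1) \<le> (1 + K) * E * (1 / K + 1)"
    by (simp add: algebra_simps)
  also have "\<dots> \<le> (1 + K) * E * (1 / K + 1) * (1 + K * T)"
    using KT assms by (intro mult_le_cancel_left1[THEN iffD2]) (auto simp: E_def not_less)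
  finally show "l1norm (z t) + (1 / K + 1)
      \<le> (1 + K) * exp (K * (b - a) * (1 + K * (b - a))) * (1 / K + 1) * (1 + K * (b - a))"
    by (simp add: E_def T_def)
qed (use assms in auto)

lemma node_Suc: "node a b n (Suc j) = node a b n j + (b - a) / real n"
  by (simp only: node_def of_nat_Suc distrib_right)

lemma node_add_in_interval:
  assumes "a < b" "j < n" "0 \<le> s" "s \<le> 1"
  shows "node a b n j + s * ((b - a) / real n) \<in> {a..b}"
proof -
  define h where "h = (b - a) / real n"
  have h: "h > 0" "real n * h = b - a" using assms by (auto simp: h_def)
  have "(real j + s) * h \<le> real n * h" using assms h by (intro mult_right_mono) linarith+
  moreover have "0 \<le> (real j + s) * h" using assms h by simp
  ultimately show ?thesis using h by (simp add: node_def h_def[symmetric] algebra_simps)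
qed

text \<open>The intermediate Euler point at which step \<open>j + 1\<close> evaluates the right-hand side, denoted
  \<open>W\<close> in the definition of \<^const>\<open>rk2\<close>.\<close>

definition rk2_stage ::
    "real \<Rightarrow> real \<Rightarrow> nat \<Rightarrow> real ^ 'd \<Rightarrow> (real \<Rightarrow> real ^ 'd \<Rightarrow> real ^ 'd) \<Rightarrow> (nat \<Rightarrow> real)
      \<Rightarrow> nat \<Rightarrow> real ^ 'd" where
  "rk2_stage a b n \<eta> f s j = rk2 a b n \<eta> f s j
     + ((b - a) / real n * s (Suc j)) *\<^sub>R f (node a b n j) (rk2 a b n \<eta> f s j)"

lemma rk2_Suc:
  "rk2 a b n \<eta> f s (Suc j) = rk2 a b n \<eta> f s j + ((b - a) / real n) *\<^sub>R
     f (node a b n j + s (Suc j) * ((b - a) / real n)) (rk2_stage a b n \<eta> f s j)"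
  by (simp add: rk2_stage_def Let_def)

text \<open>Adding \<open>1 / K + 1\<close> to the norm turns the affine growth bound \<open>K * (1 + l1norm x) + 1\<close> of the noisy
  right-hand side into the linear bound \<open>K * (l1norm x + (1 / K + 1))\<close>, so that a step multiplies the
  shifted norm by at most a fixed factor.\<close>

lemma rk2_growth_step:
  fixes f :: "real \<Rightarrow> real ^ 'd \<Rightarrow> real ^ 'd" and \<eta> :: "real ^ 'd"
  assumes "a < b" "0 < K" and s: "\<And>j. 1 \<le> j \<Longrightarrow> j \<le> n \<Longrightarrow> s j \<in> {0..1}"
    and f: "\<And>t x. t \<in> {a..b} \<Longrightarrow> l1norm (f t x) \<le> K * (1 + l1norm x) + 1"
    and j: "j < n"
  defines "h \<equiv> (b - a) / real n"
  defines "v \<equiv> \<lambda>j. l1norm (rk2 a b n \<eta> f s j) + (1 / K + 1)"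
  shows "l1norm (rk2_stage a b n \<eta> f s j) + (1 / K + 1) \<le> v j * (1 + h * K)"
    and "v (Suc j) \<le> v j * (1 + h * K * (1 + h * K))"
proof -
  have h: "h > 0" using assms by (auto simp: h_def)
  have sj: "0 \<le> s (Suc j)" "s (Suc j) \<le> 1" using s[of "Suc j"] j by auto
  have f': "l1norm (f t x) \<le> K * (l1norm x + (1 / K + 1))" if "t \<in> {a..b}" for t x
    using f[OF that, of x] \<open>0 < K\<close> by (simp add: algebra_simps)
  define V where "V = rk2 a b n \<eta> f s j"
  define W where "W = rk2_stage a b n \<eta> f s j"
  have vj: "v j = l1norm V + (1 / K + 1)" by (simp add: v_def V_def)
  have "0 < v j" using \<open>0 < K\<close> by (simp add: vj add_nonneg_pos add_pos_pos)
  have "l1norm W \<le> l1norm V + \<bar>h * s (Suc j)\<bar> * l1norm (f (node a b n j) V)"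
    unfolding W_def rk2_stage_def V_def h_def
    by (rule order_trans[OF l1norm_triangle]) (simp add: l1norm_scaleR)
  also have "\<bar>h * s (Suc j)\<bar> * l1norm (f (node a b n j) V) \<le> h * (K * v j)"
  proof (rule mult_mono)
    show "\<bar>h * s (Suc j)\<bar> \<le> h" using h sj by (simp add: abs_mult mult_left_le)
    show "l1norm (f (node a b n j) V) \<le> K * v j"
      using f'[of "node a b n j" V] node_add_in_interval[of a b j n 0] assms(1) j by (simp add: vj)
  qed (use h in auto)
  finally show W: "l1norm (rk2_stage a b n \<eta> f s j) + (1 / K + 1) \<le> v j * (1 + h * K)"
    unfolding W_def[symmetric] using \<open>0 < K\<close> by (simp add: vj algebra_simps)
  have "l1norm (rk2 a b n \<eta> f s (Suc j)) \<le>
      l1norm V + h * l1norm (f (node a b n j + s (Suc j) * h) W)"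
    unfolding rk2_Suc using h
    by (intro order_trans[OF l1norm_triangle])
      (simp add: l1norm_scaleR V_def W_def abs_of_pos flip: h_def)
  also have "\<dots> \<le> l1norm V + h * (K * (v j * (1 + h * K)))"
  proof (intro add_left_mono mult_left_mono)
    have "l1norm (f (node a b n j + s (Suc j) * h) W) \<le> K * (l1norm W + (1 / K + 1))"
      using f'[of "node a b n j + s (Suc j) * h" W] node_add_in_interval[of a b j n "s (Suc j)"]
        assms(1) j sj by (simp add: h_def)
    also have "\<dots> \<le> K * (v j * (1 + h * K))"
      using W \<open>0 < K\<close> by (intro mult_left_mono) (auto simp: W_def)
    finally show "l1norm (f (node a b n j + s (Suc j) * h) W) \<le> K * (v j * (1 + h * K))" .
  qed (use h in auto)
  finally show "v (Suc j) \<le> v j * (1 + h * K * (1 + h * K))"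
    using \<open>0 < K\<close> by (simp add: v_def V_def algebra_simps del: rk2.simps)
qed

lemma rk2_in_l1ball:
  fixes f :: "real \<Rightarrow> real ^ 'd \<Rightarrow> real ^ 'd"
  assumes "a < b" "0 < K" and s: "\<And>j. 1 \<le> j \<Longrightarrow> j \<le> n \<Longrightarrow> s j \<in> {0..1}"
    and f: "\<And>t x. t \<in> {a..b} \<Longrightarrow> l1norm (f t x) \<le> K * (1 + l1norm x) + 1"
    and \<eta>: "l1norm \<eta> \<le> K" "l1norm \<eta>' \<le> K + 1"
    and j: "j < n"
  shows "rk2 a b n \<eta>' f s j \<in> l1ball \<eta> (Rbar a b K)"
    and "rk2_stage a b n \<eta>' f s j \<in> l1ball \<eta> (Rbar a b K)"
proof -
  define h T where "h = (b - a) / real n" and "T = b - a"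
  define v where "v j = l1norm (rk2 a b n \<eta>' f s j) + (1 / K + 1)" for j
  define c where "c = h * K * (1 + h * K)"
  define E where "E = exp (K * T * (1 + K * T))"
  have h: "h > 0" "real n * h = T" "T > 0" using assms by (auto simp: h_def T_def)
  have "1 * h \<le> real n * h" using h j by (intro mult_right_mono) auto
  with h have hT: "h \<le> T" by simp
  have c: "c > 0" using h \<open>0 < K\<close> by (simp add: c_def add_pos_pos)
  have v: "v i \<le> (1 + K) * (1 / K + 1) * (1 + c) ^ i" if "i \<le> n" for i
    using that
  proof (induction i)
    case 0
    have "(1 + K) * (1 / K + 1) = K + 1 + (1 / K + 1)" using \<open>0 < K\<close> by (simp add: field_simps)
    then show ?case using \<eta> by (simp add: v_def)
  next
    case (Suc i)
    then have "v (Suc i) \<le> v i * (1 + c)"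
      using rk2_growth_step(2)[of a b K n s f i \<eta>', OF assms(1,2) s f]
        by (simp add: v_def c_def h_def)
    also have "\<dots> \<le> (1 + K) * (1 / K + 1) * (1 + c) ^ i * (1 + c)"
      using Suc c by (intro mult_right_mono) auto
    finally show ?case by (simp add: mult_ac)
  qed
  have "(1 + c) ^ j \<le> exp c ^ j" using c by (intro power_mono) auto
  also have "\<dots> = exp (real j * c)" by (simp add: exp_of_nat_mult)
  also have "\<dots> \<le> exp (real n * c)" using j c by simp
  also have "real n * c = K * T * (1 + h * K)" using h by (simp add: c_def ac_simps)
  also have "\<dots> \<le> K * T * (1 + K * T)"
    using h \<open>0 < K\<close> by (intro mult_left_mono) (auto simp: mult.commute hT)
  finally have E: "(1 + c) ^ j \<le> E" by (simp add: E_def)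
  have "(1 + K) * (1 / K + 1) * (1 + c) ^ j \<le> (1 + K) * (1 / K + 1) * E"
    using E \<open>0 < K\<close> by (intro mult_left_mono) auto
  with v[of j] j have vj: "v j \<le> (1 + K) * E * (1 / K + 1)" by (simp add: mult_ac)
  have "0 < v j" using \<open>0 < K\<close> by (simp add: v_def add_nonneg_pos add_pos_pos)
  have "v j * (1 + h * K) \<le> (1 + K) * E * (1 / K + 1) * (1 + K * T)"
    using vj h hT \<open>0 < K\<close> \<open>0 < v j\<close> by (intro mult_mono) (auto simp: E_def mult.commute)
  moreover have "v j \<le> v j * (1 + h * K)"
    using \<open>0 < v j\<close> h \<open>0 < K\<close> by (simp add: mult_le_cancel_left1)
  ultimately show "rk2 a b n \<eta>' f s j \<in> l1ball \<eta> (Rbar a b K)"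
    "rk2_stage a b n \<eta>' f s j \<in> l1ball \<eta> (Rbar a b K)"
    using rk2_growth_step(1)[of a b K n s f j \<eta>', OF assms(1,2) s f j] assms(1,2) \<eta>
    by (auto intro!: in_l1ball_RbarI simp: v_def E_def T_def h_def)
qed

section \<open>Error propagation along one path\<close>

lemma discrete_gronwall:
  fixes E :: "nat \<Rightarrow> real"
  assumes "0 \<le> B" and E: "\<And>j. j \<le> n \<Longrightarrow> E j \<le> A + B * (\<Sum>i<j. E i)" and "j \<le> n"
  shows "E j \<le> A * (1 + B) ^ j"
  using \<open>j \<le> n\<close>
proof (induction j rule: less_induct)
  case (less j)
  have geo: "B * (\<Sum>i<j. (1 + B) ^ i) = (1 + B) ^ j - 1"
    by (induction j) (auto simp: algebra_simps)
  have "(\<Sum>i<j. E i) \<le> (\<Sum>i<j. A * (1 + B) ^ i)" using less by (intro sum_mono) auto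
  then have "E j \<le> A + B * (\<Sum>i<j. A * (1 + B) ^ i)"
    using E[OF less.prems] mult_left_mono[OF _ \<open>0 \<le> B\<close>] by fastforce
  also have "B * (\<Sum>i<j. A * (1 + B) ^ i) = A * ((1 + B) ^ j - 1)"
    unfolding geo[symmetric] by (simp add: sum_distrib_left mult_ac)
  finally show ?case by (simp add: algebra_simps)
qed

lemma l1norm_le_by_decomposition:
  assumes "x = u + v + w" "l1norm u \<le> A" "l1norm v \<le> B" "l1norm w \<le> C"
  shows "l1norm x \<le> A + B + C"
  using l1norm_triangle[of "u + v" w] l1norm_triangle[of u v] assms by simp

lemma piece_exists:
  assumes ab: "a < b" and n: "0 < n" and t: "t \<in> {a..b}"
  obtains j where "j < n" "t \<in> {node a b n j..node a b n (Suc j)}"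
proof (cases "t = b")
  \<comment> \<open>For \<open>t = b\<close> the index computed by rounding down would be \<open>n\<close>, one too many.\<close>
  case True
  have "node a b n (Suc (n - 1)) = b" using n by (simp add: node_def)
  moreover have "node a b n (n - 1) \<le> b"
    using node_add_in_interval[OF ab, of "n - 1" n 0] n by simp
  ultimately show ?thesis using that[of "n - 1"] n True by auto
next
  case False
  define h where "h = (b - a) / real n"
  have h: "0 < h" "real n * h = b - a" using ab n by (auto simp: h_def)
  define j where "j = nat \<lfloor>(t - a) / h\<rfloor>"
  have pos: "0 \<le> (t - a) / h" using t h by simp
  have "(t - a) / h < real n" using t False h by (simp add: pos_divide_less_eq)
  then have "j < n" using pos by (simp add: j_def) linarith
  have 1: "real j \<le> (t - a) / h" "(t - a) / h \<le> real j + 1" using pos by (simp_all add: j_def)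
  have "t \<in> {node a b n j..node a b n (Suc j)}"
    using 1 h by (simp add: node_def h_def[symmetric] field_simps)
  with \<open>j < n\<close> show ?thesis by (rule that)
qed

text \<open>The setting for the error analysis of one path. The set \<open>U\<close> stands for the ball on which the
  Lipschitz condition holds, and \<open>\<kappa>\<close> bounds the oscillation of \<open>z' = f(\<cdot>, z)\<close> over one step; for Hoelder
  continuous data it is of order \<open>h\<^sup>\<rho>\<close>.\<close>

locale perturbed_ivp =
  fixes a b L \<delta> \<kappa> :: real and n :: nat and U :: "(real ^ 'd) set"
    and \<eta> \<eta>' :: "real ^ 'd" and f f' :: "real \<Rightarrow> real ^ 'd \<Rightarrow> real ^ 'd" and z :: "real \<Rightarrow> real ^ 'd"
  assumes ab: "a < b" and n: "0 < n" and L: "0 \<le> L" and \<delta>: "0 \<le> \<delta>"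
    and z: "solves_ivp a b \<eta> f z"
    and z_U: "\<And>t. t \<in> {a..b} \<Longrightarrow> z t \<in> U"
    and lipschitz: "\<And>t x y. t \<in> {a..b} \<Longrightarrow> x \<in> U \<Longrightarrow> y \<in> U \<Longrightarrow>
      l1norm (f t x - f t y) \<le> L * l1norm (x - y)"
    and modulus: "\<And>t r. t \<in> {a..b} \<Longrightarrow> r \<in> {a..b} \<Longrightarrow> \<bar>r - t\<bar> \<le> (b - a) / real n \<Longrightarrow>
      l1norm (f r (z r) - f t (z t)) \<le> \<kappa>"
    and noise: "\<And>t x. t \<in> {a..b} \<Longrightarrow> l1norm (f t x - f' t x) \<le> \<delta>"
    and noise_init: "l1norm (\<eta> - \<eta>') \<le> \<delta>"
begin

definition h :: real where "h = (b - a) / real n"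

definition err :: "(nat \<Rightarrow> real) \<Rightarrow> nat \<Rightarrow> real ^ 'd" where
  "err s j = z (node a b n j) - rk2 a b n \<eta>' f' s j"

text \<open>
  The error of replacing the integral of \<open>z'\<close> over one step by a single evaluation at the randomly
  chosen point. It depends on the exact solution only, not on the computed values; this is what makes the
  errors of different steps independent.
\<close>

definition quad_err :: "(nat \<Rightarrow> real) \<Rightarrow> nat \<Rightarrow> real ^ 'd" where
  "quad_err s j = z (node a b n (Suc j)) - z (node a b n j)
     - h *\<^sub>R f (node a b n j + s (Suc j) * h) (z (node a b n j + s (Suc j) * h))"

lemma step_size: "0 < h" "real n * h = b - a"
  using ab n by (auto simp: h_def)

lemma modulus_nonneg: "0 \<le> \<kappa>"
  using modulus[of a a] ab by simp

lemma node_in [simp]: "j \<le> n \<Longrightarrow> node a b n j \<in> {a..b}"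
  using mult_right_mono[of "real j" "real n" h] step_size by (auto simp: node_def h_def[symmetric])

text \<open>Euler's approximation with the slope taken at an arbitrary point of the interval: with \<open>c = t\<close> it
  serves for the stage and the interpolation, with the random point for the quadrature error.\<close>

lemma taylor:
  assumes "a \<le> t" "t \<le> r" "r \<le> b" "r - t \<le> h" and c: "c \<in> {t..r}"
  shows "l1norm (z r - z t - (r - t) *\<^sub>R f c (z c)) \<le> \<kappa> * h"
proof -
  have "l1norm ((z r - r *\<^sub>R f c (z c)) - (z t - t *\<^sub>R f c (z c))) \<le> \<kappa> * r - \<kappa> * t"
  proof (rule l1norm_mean_value[where z' = "\<lambda>u. f u (z u) - f c (z c)" and \<phi>' = "\<lambda>_. \<kappa>"])
    fix u assume u: "u \<in> {t..r}"
    then have u': "u \<in> {a..b}" using assms by auto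
    have "(z has_vector_derivative f u (z u)) (at u within {t..r})"
      by (rule has_vector_derivative_within_subset[of _ _ _ "{a..b}"])
        (use z u' assms in \<open>auto simp: solves_ivp_def\<close>)
    then show "((\<lambda>u. z u - u *\<^sub>R f c (z c)) has_vector_derivative f u (z u) - f c (z c)) (at u within {t..r})"
      by (auto intro!: derivative_eq_intros)
    have "\<bar>u - c\<bar> \<le> h" using u c assms(4) by (auto simp: abs_le_iff)
    then show "l1norm (f u (z u) - f c (z c)) \<le> \<kappa>"
      using u' c assms by (intro modulus) (auto simp: h_def)
  qed (use assms in \<open>auto intro!: derivative_eq_intros\<close>)
  also have "\<dots> \<le> \<kappa> * h"
    using mult_left_mono[OF assms(4) modulus_nonneg] by (simp add: algebra_simps)
  finally show ?thesis by (simp add: algebra_simps)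
qed

lemma quad_err_le:
  assumes j: "j < n" and s: "s (Suc j) \<in> {0..1}"
  shows "l1norm (quad_err s j) \<le> \<kappa> * h"
proof -
  have nS: "node a b n (Suc j) = node a b n j + h" by (simp add: node_Suc h_def)
  have "s (Suc j) * h \<le> h" using s step_size by (simp add: mult_left_le_one_le)
  then show ?thesis
    using taylor[of "node a b n j" "node a b n j + h" "node a b n j + s (Suc j) * h"]
      node_in[of j] node_in[of "Suc j"] j s step_size(1)
    by (simp add: quad_err_def nS)
qed

text \<open>After subtracting the quadrature error, what remains of one step is \<open>h\<close> times the difference between
  \<open>z'\<close> and the noisy right-hand side at the random point. The Lipschitz condition is used twice: for
  that difference, and once more for the slope that leads to the stage, whence the factor \<open>1 + h * L\<close>.\<close>

lemma err_step:
  assumes j: "j < n" and s: "s (Suc j) \<in> {0..1}"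
    and V: "rk2 a b n \<eta>' f' s j \<in> U" and W: "rk2_stage a b n \<eta>' f' s j \<in> U"
  shows "l1norm (err s (Suc j) - err s j - quad_err s j)
    \<le> h * L * (1 + h * L) * l1norm (err s j) + h * (L * (\<kappa> * h + h * \<delta>) + \<delta>)"
proof -
  define t \<theta> where "t = node a b n j" and "\<theta> = t + s (Suc j) * h"
  define V' W' where "V' = rk2 a b n \<eta>' f' s j" and "W' = rk2_stage a b n \<eta>' f' s j"
  define e where "e = l1norm (err s j)"
  have t: "t \<in> {a..b}" using j unfolding t_def by (intro node_in) simp
  have \<theta>: "\<theta> \<in> {a..b}"
    using s unfolding \<theta>_def t_def h_def by (intro node_add_in_interval[OF ab j]) auto
  have sh: "0 \<le> h * s (Suc j)" "h * s (Suc j) \<le> h" using s step_size by (auto intro: mult_left_le)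
  have "l1norm (f t (z t) - f' t V') \<le> L * e + \<delta>"
    using l1norm_triangle[of "f t (z t) - f t V'" "f t V' - f' t V'"] noise[OF t, of V']
      lipschitz[OF t z_U[OF t], of V'] V
    by (simp add: V'_def e_def err_def t_def)
  then have "\<bar>h * s (Suc j)\<bar> * l1norm (f t (z t) - f' t V') \<le> h * (L * e + \<delta>)"
    using sh by (intro mult_mono) (auto simp: abs_of_nonneg)
  then have 3: "l1norm ((h * s (Suc j)) *\<^sub>R (f t (z t) - f' t V')) \<le> h * (L * e + \<delta>)"
    by (simp add: l1norm_scaleR)
  have 2: "l1norm (z \<theta> - z t - (h * s (Suc j)) *\<^sub>R f t (z t)) \<le> \<kappa> * h"
    using taylor[of t \<theta> t] t \<theta> sh by (simp add: \<theta>_def mult.commute)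
  have "z \<theta> - W' = (z t - V') + (z \<theta> - z t - (h * s (Suc j)) *\<^sub>R f t (z t))
      + (h * s (Suc j)) *\<^sub>R (f t (z t) - f' t V')"
    by (simp add: W'_def rk2_stage_def h_def[symmetric] V'_def t_def algebra_simps)
  from l1norm_le_by_decomposition[OF this _ 2 3, of e]
  have zW: "l1norm (z \<theta> - W') \<le> e + \<kappa> * h + h * (L * e + \<delta>)"
    by (simp add: e_def err_def V'_def t_def)
  have "l1norm (f \<theta> (z \<theta>) - f' \<theta> W') \<le> L * l1norm (z \<theta> - W') + \<delta>"
    using l1norm_triangle[of "f \<theta> (z \<theta>) - f \<theta> W'" "f \<theta> W' - f' \<theta> W'"] noise[OF \<theta>, of W']
      lipschitz[OF \<theta> z_U[OF \<theta>], of W'] W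
    by (simp add: W'_def)
  also have "\<dots> \<le> L * (e + \<kappa> * h + h * (L * e + \<delta>)) + \<delta>"
    using zW L by (intro add_right_mono mult_left_mono)
  finally have "h * l1norm (f \<theta> (z \<theta>) - f' \<theta> W') \<le> h * (L * (e + \<kappa> * h + h * (L * e + \<delta>)) + \<delta>)"
    using step_size by (intro mult_left_mono) auto
  moreover have eq: "err s (Suc j) - err s j - quad_err s j = h *\<^sub>R (f \<theta> (z \<theta>) - f' \<theta> W')"
    by (simp add: err_def quad_err_def rk2_Suc W'_def \<theta>_def t_def h_def[symmetric] algebra_simps
        del: rk2.simps)
  ultimately show ?thesis using step_size(1)
    unfolding eq l1norm_scaleR e_def[symmetric] by (simp add: algebra_simps)
qed

text \<open>The quadrature errors enter only through their partial sums, not through the sum of their norms;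
  the cancellation between the steps is preserved by summing the recursion before applying Gronwall.\<close>

lemma err_bound:
  assumes s: "\<And>j. 1 \<le> j \<Longrightarrow> j \<le> n \<Longrightarrow> s j \<in> {0..1}"
    and V: "\<And>j. j < n \<Longrightarrow> rk2 a b n \<eta>' f' s j \<in> U"
    and W: "\<And>j. j < n \<Longrightarrow> rk2_stage a b n \<eta>' f' s j \<in> U"
    and m: "\<And>j. j \<le> n \<Longrightarrow> l1norm (\<Sum>i<j. quad_err s i) \<le> m"
    and j: "j \<le> n"
  shows "l1norm (err s j) \<le> (\<delta> + m + (b - a) * (L * (\<kappa> * h + h * \<delta>) + \<delta>)) * exp ((b - a) * L * (1 + h * L))"
proof -
  define B c where "B = h * L * (1 + h * L)" and "c = L * (\<kappa> * h + h * \<delta>) + \<delta>"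
  define A where "A = \<delta> + m + (b - a) * c"
  have B: "0 \<le> B" using step_size L by (simp add: B_def)
  have c: "0 \<le> c" using step_size L \<delta> modulus_nonneg by (simp add: c_def)
  have m0: "0 \<le> m" using m[of 0] by simp
  have A: "0 \<le> A" using c m0 \<delta> ab by (simp add: A_def)
  have "l1norm (err s i) \<le> A + B * (\<Sum>k<i. l1norm (err s k))" if i: "i \<le> n" for i
  proof -
    define r where "r k = err s (Suc k) - err s k - quad_err s k" for k
    have "err s i = err s 0 + (\<Sum>k<i. quad_err s k) + (\<Sum>k<i. r k)"
      by (induction i) (auto simp: r_def)
    moreover have "l1norm (err s 0) \<le> \<delta>"
      using noise_init z by (simp add: err_def node_def solves_ivp_def)
    moreover have "l1norm (\<Sum>k<i. r k) \<le> B * (\<Sum>k<i. l1norm (err s k)) + (b - a) * c"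
    proof -
      have "l1norm (\<Sum>k<i. r k) \<le> (\<Sum>k<i. B * l1norm (err s k) + h * c)"
        unfolding r_def B_def c_def
        by (rule order_trans[OF l1norm_sum]) (use i in \<open>intro sum_mono err_step s V W, auto\<close>)
      also have "\<dots> = B * (\<Sum>k<i. l1norm (err s k)) + real i * h * c"
        by (simp add: sum.distrib sum_distrib_left)
      also have "real i * h * c \<le> real n * h * c"
        using i step_size c by (intro mult_right_mono) auto
      finally show ?thesis using step_size by simp
    qed
    ultimately have "l1norm (err s i) \<le> \<delta> + m + (B * (\<Sum>k<i. l1norm (err s k)) + (b - a) * c)"
      using m[OF i] by (intro l1norm_le_by_decomposition)
    then show ?thesis by (simp add: A_def)
  qed
  from discrete_gronwall[OF B this j] have "l1norm (err s j) \<le> A * (1 + B) ^ j" .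
  also have "(1 + B) ^ j \<le> exp B ^ j" using B by (intro power_mono) auto
  also have "exp B ^ j = exp (real j * B)" by (simp add: exp_of_nat_mult)
  also have "\<dots> \<le> exp (real n * B)" using j B by (simp add: mult_right_mono)
  also have "real n * B = (b - a) * L * (1 + h * L)"
    using step_size by (simp add: B_def flip: step_size(2))
  finally show ?thesis using A by (simp add: A_def c_def mult_left_mono)
qed

text \<open>Interpolating the exact nodal values linearly costs \<open>2 * \<kappa> * h\<close>, and the interpolated nodal errors
  form a convex combination.\<close>

lemma interp_error:
  assumes m: "\<And>j. j \<le> n \<Longrightarrow> l1norm (err s j) \<le> m" and t: "t \<in> {a..b}"
  shows "l1norm (z t - rk2_interp a b n \<eta>' f' s t) \<le> m + 2 * \<kappa> * h"
proof -
  obtain j where j: "j < n" "t \<in> {node a b n j..node a b n (Suc j)}" using piece_exists[OF ab n t] .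
  define u where "u = node a b n j"
  define \<sigma> where "\<sigma> = (t - u) / h"
  define g where "g = f u (z u)"
  have nS: "node a b n (Suc j) = u + h" by (simp add: node_Suc u_def h_def)
  have \<sigma>: "0 \<le> \<sigma>" "\<sigma> \<le> 1" "t - u = \<sigma> * h"
    using j(2) step_size by (auto simp: \<sigma>_def nS u_def[symmetric])
  have u: "u \<in> {a..b}" "u + h \<in> {a..b}"
    using node_in[of j] node_in[of "Suc j"] j by (auto simp: u_def[symmetric] nS)
  have 1: "l1norm ((1 - \<sigma>) *\<^sub>R err s j + \<sigma> *\<^sub>R err s (Suc j)) \<le> m"
  proof -
    have "l1norm ((1 - \<sigma>) *\<^sub>R err s j + \<sigma> *\<^sub>R err s (Suc j)) \<le> (1 - \<sigma>) * m + \<sigma> * m"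
      using \<sigma> m[of j] m[of "Suc j"] j
      by (intro order_trans[OF l1norm_triangle] add_mono) (auto simp: l1norm_scaleR intro!: mult_left_mono)
    then show ?thesis by (simp add: algebra_simps)
  qed
  have 2: "l1norm (z t - z u - (t - u) *\<^sub>R g) \<le> \<kappa> * h"
    unfolding g_def using u t j step_size(1) by (intro taylor) (auto simp: u_def[symmetric] nS)
  have "l1norm (z (u + h) - z u - h *\<^sub>R g) \<le> \<kappa> * h"
    using taylor[of u "u + h" u] u step_size(1) by (simp add: g_def)
  then have 3: "l1norm ((- \<sigma>) *\<^sub>R (z (u + h) - z u - h *\<^sub>R g)) \<le> \<kappa> * h"
    using \<sigma> mult_mono[of \<sigma> 1] by (force simp: l1norm_scaleR)
  have "rk2_interp a b n \<eta>' f' s t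
      = \<sigma> *\<^sub>R (rk2 a b n \<eta>' f' s (Suc j) - rk2 a b n \<eta>' f' s j) + rk2 a b n \<eta>' f' s j"
    using rk2_interp_on_piece[OF ab n j(2), of \<eta>' f' s]
      by (simp add: nS u_def[symmetric] \<sigma>_def del: rk2.simps)
  then have "z t - rk2_interp a b n \<eta>' f' s t = ((1 - \<sigma>) *\<^sub>R err s j + \<sigma> *\<^sub>R err s (Suc j))
      + (z t - z u - (t - u) *\<^sub>R g) + (- \<sigma>) *\<^sub>R (z (u + h) - z u - h *\<^sub>R g)"
    unfolding err_def nS u_def[symmetric] \<sigma>(3) by (simp add: algebra_simps del: rk2.simps)
  from l1norm_le_by_decomposition[OF this 1 2 3] show ?thesis by simp
qed

lemma sup_error_bound:
  assumes s: "\<And>j. 1 \<le> j \<Longrightarrow> j \<le> n \<Longrightarrow> s j \<in> {0..1}"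
    and V: "\<And>j. j < n \<Longrightarrow> rk2 a b n \<eta>' f' s j \<in> U"
    and W: "\<And>j. j < n \<Longrightarrow> rk2_stage a b n \<eta>' f' s j \<in> U"
    and m: "\<And>j. j \<le> n \<Longrightarrow> l1norm (\<Sum>i<j. quad_err s i) \<le> m"
  defines "B \<equiv> (\<delta> + m + (b - a) * (L * (\<kappa> * h + h * \<delta>) + \<delta>)) * exp ((b - a) * L * (1 + h * L)) + 2 * \<kappa> * h"
  shows "0 \<le> sup_error a b z (rk2_interp a b n \<eta>' f' s)" "sup_error a b z (rk2_interp a b n \<eta>' f' s) \<le> B"
proof -
  have B: "l1norm (z t - rk2_interp a b n \<eta>' f' s t) \<le> B" if "t \<in> {a..b}" for t
    unfolding B_def by (intro interp_error err_bound s V W m that)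
  then have "bdd_above ((\<lambda>t. l1norm (z t - rk2_interp a b n \<eta>' f' s t)) ` {a..b})"
    by (intro bdd_aboveI2[of _ _ B])
  then show "0 \<le> sup_error a b z (rk2_interp a b n \<eta>' f' s)"
    unfolding sup_error_def using ab by (intro cSUP_upper2[of _ _ a]) auto
  show "sup_error a b z (rk2_interp a b n \<eta>' f' s) \<le> B"
    unfolding sup_error_def using ab B by (intro cSUP_least) auto
qed

end

section \<open>Maximal inequalities for sums of independent bounded variables\<close>

text \<open>Doob's \<open>L\<^sup>2\<close> maximal inequality for a nonnegative submartingale in deterministic form: the sum on
  the left is a discrete stochastic integral, whose expectation is nonnegative when \<open>x\<close> is a submartingale
  and its running maximum \<open>m\<close> is nonnegative. The induction rests on the sharper bound
  \<open>4 * m n * x n - 2 * (m n)\<^sup>2\<close> for four times that sum; the increments of both agree as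
  long as no new maximum is reached.\<close>

lemma doob_pathwise:
  fixes x :: "nat \<Rightarrow> real"
  defines "m \<equiv> \<lambda>k. Max (x ` {..k})"
  shows "(m n)\<^sup>2 + 4 * (\<Sum>i<n. m i * (x (Suc i) - x i)) \<le> 4 * (x n)\<^sup>2"
proof -
  have "4 * (\<Sum>i<n. m i * (x (Suc i) - x i)) \<le> 4 * m n * x n - 2 * (m n)\<^sup>2"
  proof (induction n)
    case 0
    then show ?case by (simp add: m_def power2_eq_square)
  next
    case (Suc n)
    have mS: "m (Suc n) = max (x (Suc n)) (m n)"
      by (simp add: m_def atMost_Suc)
    have "4 * m n * (x (Suc n) - x n)
      \<le> (4 * m (Suc n) * x (Suc n) - 2 * (m (Suc n))\<^sup>2) - (4 * m n * x n - 2 * (m n)\<^sup>2)"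
    proof (cases "x (Suc n) \<le> m n")
      case True
      then have "m (Suc n) = m n" by (simp add: mS)
      then show ?thesis by (simp add: algebra_simps)
    next
      case False
      then have "m (Suc n) = x (Suc n)" by (simp add: mS)
      moreover have "0 \<le> 2 * (x (Suc n) - m n)\<^sup>2" by simp
      ultimately show ?thesis by (simp add: power2_eq_square algebra_simps)
    qed
    with Suc show ?case by (simp add: algebra_simps)
  qed
  moreover have "0 \<le> (m n - 2 * x n)\<^sup>2" by simp
  ultimately show ?thesis by (simp add: power2_eq_square algebra_simps)
qed

context prob_space
begin

lemma expectation_past_times_next:
  fixes D :: "nat \<Rightarrow> 'a \<Rightarrow> real" and F :: "(nat \<Rightarrow> real) \<Rightarrow> real" and G :: "real \<Rightarrow> real"
  assumes ind: "indep_vars (\<lambda>_. borel) D {1..n}" and i: "i < n"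
    and F: "F \<in> borel_measurable (PiM {1..i} (\<lambda>_. borel))" and G: "G \<in> borel_measurable borel"
    and intF: "integrable M (\<lambda>\<omega>. F (\<lambda>j\<in>{1..i}. D j \<omega>))"
    and intG: "integrable M (\<lambda>\<omega>. G (D (Suc i) \<omega>))"
  shows "expectation (\<lambda>\<omega>. F (\<lambda>j\<in>{1..i}. D j \<omega>) * G (D (Suc i) \<omega>))
    = expectation (\<lambda>\<omega>. F (\<lambda>j\<in>{1..i}. D j \<omega>)) * expectation (\<lambda>\<omega>. G (D (Suc i) \<omega>))"
proof -
  have "indep_var (PiM {1..i} (\<lambda>_. borel)) (\<lambda>\<omega>. \<lambda>j\<in>{1..i}. D j \<omega>)
      (PiM {Suc i} (\<lambda>_. borel)) (\<lambda>\<omega>. \<lambda>j\<in>{Suc i}. D j \<omega>)"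
    using i by (intro indep_var_restrict[OF ind]) auto
  moreover have "(\<lambda>y. G (y (Suc i))) \<in> borel_measurable (PiM {Suc i} (\<lambda>_. borel :: real measure))"
    by (rule measurable_compose[OF _ G], rule measurable_component_singleton) simp
  ultimately have "indep_var borel (F \<circ> (\<lambda>\<omega>. \<lambda>j\<in>{1..i}. D j \<omega>))
      borel ((\<lambda>y. G (y (Suc i))) \<circ> (\<lambda>\<omega>. \<lambda>j\<in>{Suc i}. D j \<omega>))"
    by (rule indep_var_compose[OF _ F])
  then have "indep_var borel (\<lambda>\<omega>. F (\<lambda>j\<in>{1..i}. D j \<omega>)) borel (\<lambda>\<omega>. G (D (Suc i) \<omega>))"
    by (simp add: comp_def)
  from indep_var_lebesgue_integral[OF this intF intG] show ?thesis .
qed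

lemma expectation_exp_le_Hoeffding:
  fixes X :: "'a \<Rightarrow> real"
  assumes [measurable]: "X \<in> borel_measurable M" and bd: "\<And>\<omega>. \<bar>X \<omega>\<bar> \<le> c"
    and E0: "expectation X = 0" and \<theta>: "0 < \<theta>"
  shows "expectation (\<lambda>\<omega>. exp (\<theta> * X \<omega>)) \<le> exp (\<theta>\<^sup>2 * c\<^sup>2 / 2)"
proof -
  interpret interval_bounded_random_variable M X "- c" c
    using bd by unfold_locales (auto simp: abs_le_iff minus_le_iff)
  have "integrable M (\<lambda>\<omega>. exp (\<theta> * X \<omega>))"
  proof (rule integrable_const_bound[where B = "exp (\<theta> * c)"])
    show "AE \<omega> in M. norm (exp (\<theta> * X \<omega>)) \<le> exp (\<theta> * c)"
      using bd \<theta> by (auto intro!: mult_left_mono simp: abs_le_iff)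
  qed simp
  then have "ennreal (expectation (\<lambda>\<omega>. exp (\<theta> * X \<omega>))) \<le> ennreal (exp (\<theta>\<^sup>2 * (c - (- c))\<^sup>2 / 8))"
    using Hoeffdings_lemma_nn_integral_0[OF \<theta> E0] by (subst nn_integral_eq_integral[symmetric]) auto
  moreover have "\<theta>\<^sup>2 * (c - (- c))\<^sup>2 / 8 = \<theta>\<^sup>2 * c\<^sup>2 / 2" by (simp add: power2_eq_square)
  ultimately show ?thesis by simp
qed

text \<open>Jensen's inequality for the exponential at a centred variable; it makes the exponentials of the
  partial sums a submartingale.\<close>

lemma expectation_exp_ge_1:
  fixes X :: "'a \<Rightarrow> real"
  assumes "integrable M X" "expectation X = 0" "integrable M (\<lambda>\<omega>. exp (\<theta> * X \<omega>))"
  shows "1 \<le> expectation (\<lambda>\<omega>. exp (\<theta> * X \<omega>))"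
proof -
  have "expectation (\<lambda>\<omega>. 1 + \<theta> * X \<omega>) \<le> expectation (\<lambda>\<omega>. exp (\<theta> * X \<omega>))"
    using assms by (intro integral_mono exp_ge_add_one_self) auto
  then show ?thesis using assms by (simp add: prob_space)
qed

text \<open>Up to the factor \<open>4\<close>, the maximum of the partial sums has the same sub-Gaussian exponential moment as the
  last one. The pathwise inequality is applied to \<open>exp (\<theta> / 2 * S k)\<close>, half the exponent, since it
  squares the maximum.\<close>

lemma exp_maximal_inequality:
  fixes D :: "nat \<Rightarrow> 'a \<Rightarrow> real"
  defines "S \<equiv> \<lambda>k \<omega>. \<Sum>i=1..k. D i \<omega>"
  assumes ind: "indep_vars (\<lambda>_. borel) D {1..n}"
    and bd: "\<And>i \<omega>. i \<in> {1..n} \<Longrightarrow> \<bar>D i \<omega>\<bar> \<le> c" and c: "0 \<le> c"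
    and E0: "\<And>i. i \<in> {1..n} \<Longrightarrow> expectation (D i) = 0" and \<theta>: "0 < \<theta>"
  shows "integrable M (\<lambda>\<omega>. Max ((\<lambda>k. exp (\<theta> * S k \<omega>)) ` {..n}))"
    and "expectation (\<lambda>\<omega>. Max ((\<lambda>k. exp (\<theta> * S k \<omega>)) ` {..n})) \<le> 4 * exp (real n * \<theta>\<^sup>2 * c\<^sup>2 / 2)"
proof -
  have D [measurable]: "D i \<in> borel_measurable M" if "i \<in> {1..n}" for i
    using ind that by (auto simp: indep_vars_def)
  have S_meas [measurable]: "S k \<in> borel_measurable M" if "k \<le> n" for k
    unfolding S_def using that by (intro borel_measurable_sum D) auto
  have S_bd: "\<bar>S k \<omega>\<bar> \<le> real n * c" if "k \<le> n" for k \<omega>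
  proof -
    have "\<bar>S k \<omega>\<bar> \<le> (\<Sum>i=1..k. \<bar>D i \<omega>\<bar>)" unfolding S_def by (rule sum_abs)
    also have "\<dots> \<le> real (card {1..k}) * c" using bd that by (intro sum_bounded_above) auto
    also have "\<dots> \<le> real n * c" using that c by (intro mult_right_mono) auto
    finally show ?thesis .
  qed
  define R where "R = exp (\<theta> * (real n * c))"
  have R: "0 < R" by (simp add: R_def)
  have exp_bd: "exp (\<mu> * S k \<omega>) \<le> R" if "k \<le> n" "0 < \<mu>" "\<mu> \<le> \<theta>" for k \<omega> \<mu>
  proof -
    have "\<mu> * S k \<omega> \<le> \<mu> * (real n * c)"
      using S_bd[OF that(1), of \<omega>] that by (intro mult_left_mono) auto
    also have "\<dots> \<le> \<theta> * (real n * c)" using that c by (intro mult_right_mono) auto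
    finally show ?thesis by (simp add: R_def)
  qed
  have int_D: "integrable M (D i)" if "i \<in> {1..n}" for i
    using bd[OF that] D[OF that] by (intro integrable_const_bound[where B = c]) auto
  have int_expD: "integrable M (\<lambda>\<omega>. exp (\<mu> * D i \<omega>))" if "i \<in> {1..n}" "0 < \<mu>" for i \<mu>
  proof (rule integrable_const_bound[where B = "exp (\<mu> * c)"])
    show "AE \<omega> in M. norm (exp (\<mu> * D i \<omega>)) \<le> exp (\<mu> * c)"
      using bd[OF that(1)] that(2) by (auto intro!: mult_left_mono simp: abs_le_iff)
    show "(\<lambda>\<omega>. exp (\<mu> * D i \<omega>)) \<in> borel_measurable M" using D[OF that(1)] by simp
  qed
  have int_expS: "integrable M (\<lambda>\<omega>. exp (\<mu> * S k \<omega>))" if "k \<le> n" "0 < \<mu>" "\<mu> \<le> \<theta>" for k \<mu>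
    using exp_bd[OF that] S_meas[OF that(1)]
    by (intro integrable_const_bound[where B = R]) auto
  have E_expS: "expectation (\<lambda>\<omega>. exp (\<theta> * S k \<omega>)) \<le> exp (\<theta>\<^sup>2 * c\<^sup>2 / 2) ^ k" if "k \<le> n" for k
    using that
  proof (induction k)
    case 0
    then show ?case by (simp add: S_def prob_space)
  next
    case (Suc k)
    define F where "F y = exp (\<theta> * (\<Sum>i=1..k. y i))" for y :: "nat \<Rightarrow> real"
    have F: "F \<in> borel_measurable (PiM {1..k} (\<lambda>_. borel))" unfolding F_def by measurable
    have FS: "F (\<lambda>j\<in>{1..k}. D j \<omega>) = exp (\<theta> * S k \<omega>)" for \<omega> by (simp add: F_def S_def)
    have "expectation (\<lambda>\<omega>. exp (\<theta> * S (Suc k) \<omega>))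
        = expectation (\<lambda>\<omega>. F (\<lambda>j\<in>{1..k}. D j \<omega>) * exp (\<theta> * D (Suc k) \<omega>))"
      unfolding FS by (simp add: S_def distrib_left exp_add)
    also have "\<dots> = expectation (\<lambda>\<omega>. exp (\<theta> * S k \<omega>)) * expectation (\<lambda>\<omega>. exp (\<theta> * D (Suc k) \<omega>))"
      using Suc.prems \<theta> int_expS[of k \<theta>] int_expD[of "Suc k" \<theta>]
      by (subst expectation_past_times_next[OF ind _ F]) (auto simp: FS[unfolded One_nat_def])
    also have "\<dots> \<le> exp (\<theta>\<^sup>2 * c\<^sup>2 / 2) ^ k * exp (\<theta>\<^sup>2 * c\<^sup>2 / 2)"
      using Suc D[of "Suc k"] bd[of "Suc k"] E0[of "Suc k"] \<theta>
      by (intro mult_mono expectation_exp_le_Hoeffding) auto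
    finally show ?case by (simp add: mult_ac)
  qed
  define x where "x k \<omega> = exp (\<theta> / 2 * S k \<omega>)" for k \<omega>
  define m where "m k \<omega> = Max ((\<lambda>i. x i \<omega>) ` {..k})" for k \<omega>
  have x_bd: "0 \<le> x k \<omega>" "x k \<omega> \<le> R" if "k \<le> n" for k \<omega>
    using exp_bd[OF that, of "\<theta> / 2"] \<theta> by (auto simp: x_def)
  have x_meas [measurable]: "x k \<in> borel_measurable M" if "k \<le> n" for k
    using S_meas[OF that] unfolding x_def by simp
  have m_meas [measurable]: "m k \<in> borel_measurable M" if "k \<le> n" for k
    using that unfolding m_def by (intro borel_measurable_Max x_meas) auto
  have m_bd: "0 \<le> m k \<omega>" "m k \<omega> \<le> R" if "k \<le> n" for k \<omega>
    using x_bd that by (auto simp: m_def Max_ge_iff intro!: bexI[of _ k])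
  have int_mx: "integrable M (\<lambda>\<omega>. m i \<omega> * x k \<omega>)" if "i \<le> n" "k \<le> n" for i k
    using m_bd[OF that(1)] x_bd[OF that(2)] m_meas[OF that(1)] x_meas[OF that(2)]
    by (intro integrable_const_bound[where B = "R * R"]) (use R in \<open>auto simp: abs_mult intro!: AE_I2 mult_mono\<close>)
  \<comment> \<open>The increment of \<open>x\<close> is \<open>x i\<close> times a factor that is independent of the past and
    nonnegative on average.\<close>
  have drift: "0 \<le> expectation (\<lambda>\<omega>. m i \<omega> * (x (Suc i) \<omega> - x i \<omega>))" if i: "i < n" for i
  proof -
    define F where "F y = Max ((\<lambda>k. exp (\<theta> / 2 * (\<Sum>j=1..k. y j))) ` {..i}) * exp (\<theta> / 2 * (\<Sum>j=1..i. y j))"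
      for y :: "nat \<Rightarrow> real"
    have comp: "(\<lambda>y. \<Sum>j=1..k. y j) \<in> borel_measurable (PiM {1..i} (\<lambda>_. borel :: real measure))"
      if "k \<le> i" for k
      using that by (intro borel_measurable_sum measurable_component_singleton) auto
    have F: "F \<in> borel_measurable (PiM {1..i} (\<lambda>_. borel))"
      unfolding F_def using comp by (intro borel_measurable_times borel_measurable_Max) auto
    have FS: "F (\<lambda>j\<in>{1..i}. D j \<omega>) = m i \<omega> * x i \<omega>" for \<omega>
    proof -
      have "(\<Sum>j=1..k. (\<lambda>j\<in>{1..i}. D j \<omega>) j) = S k \<omega>" if "k \<le> i" for k
        using that unfolding S_def by (intro sum.cong) auto
      then show ?thesis by (simp add: F_def m_def x_def)
    qed
    have int: "integrable M (\<lambda>\<omega>. exp (\<theta> / 2 * D (Suc i) \<omega>))"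
      using i \<theta> by (intro int_expD) auto
    have "m i \<omega> * (x (Suc i) \<omega> - x i \<omega>)
        = F (\<lambda>j\<in>{1..i}. D j \<omega>) * (exp (\<theta> / 2 * D (Suc i) \<omega>) - 1)" for \<omega>
      unfolding FS by (simp add: x_def S_def distrib_left exp_add algebra_simps)
    then have "expectation (\<lambda>\<omega>. m i \<omega> * (x (Suc i) \<omega> - x i \<omega>))
        = expectation (\<lambda>\<omega>. m i \<omega> * x i \<omega>) * expectation (\<lambda>\<omega>. exp (\<theta> / 2 * D (Suc i) \<omega>) - 1)"
      using i int int_mx[of i i]
      by (simp only:, subst expectation_past_times_next[OF ind i F]) (auto simp: FS[unfolded One_nat_def])
    also have "\<dots> \<ge> 0"
    proof (rule mult_nonneg_nonneg)
      show "0 \<le> expectation (\<lambda>\<omega>. m i \<omega> * x i \<omega>)"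
        using m_bd x_bd i by (intro integral_nonneg_AE) auto
      have "1 \<le> expectation (\<lambda>\<omega>. exp (\<theta> / 2 * D (Suc i) \<omega>))"
        using i int int_D E0 by (intro expectation_exp_ge_1) auto
      then show "0 \<le> expectation (\<lambda>\<omega>. exp (\<theta> / 2 * D (Suc i) \<omega>) - 1)"
        using int by (simp add: prob_space)
    qed
    finally show ?thesis .
  qed
  have x2: "(x n \<omega>)\<^sup>2 = exp (\<theta> * S n \<omega>)" for \<omega>
    by (simp add: x_def power2_eq_square flip: exp_add)
  have int_m2: "integrable M (\<lambda>\<omega>. (m n \<omega>)\<^sup>2)"
    using m_bd m_meas by (intro integrable_const_bound[where B = "R\<^sup>2"]) (auto intro!: AE_I2 power_mono)
  have int_drift: "integrable M (\<lambda>\<omega>. m i \<omega> * (x (Suc i) \<omega> - x i \<omega>))" if "i < n" for i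
    unfolding right_diff_distrib
      using that by (intro Bochner_Integration.integrable_diff int_mx) auto
  have "expectation (\<lambda>\<omega>. (m n \<omega>)\<^sup>2 + 4 * (\<Sum>i<n. m i \<omega> * (x (Suc i) \<omega> - x i \<omega>)))
      \<le> expectation (\<lambda>\<omega>. 4 * (x n \<omega>)\<^sup>2)"
  proof (rule integral_mono)
    show "integrable M (\<lambda>\<omega>. (m n \<omega>)\<^sup>2 + 4 * (\<Sum>i<n. m i \<omega> * (x (Suc i) \<omega> - x i \<omega>)))"
      using int_drift by (intro Bochner_Integration.integrable_add int_m2 integrable_mult_right
        Bochner_Integration.integrable_sum) auto
    show "integrable M (\<lambda>\<omega>. 4 * (x n \<omega>)\<^sup>2)"
      unfolding x2 using int_expS[of n \<theta>] \<theta> by simp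
    show "(m n \<omega>)\<^sup>2 + 4 * (\<Sum>i<n. m i \<omega> * (x (Suc i) \<omega> - x i \<omega>)) \<le> 4 * (x n \<omega>)\<^sup>2" for \<omega>
      unfolding m_def by (rule doob_pathwise)
  qed
  moreover have "expectation (\<lambda>\<omega>. (m n \<omega>)\<^sup>2 + 4 * (\<Sum>i<n. m i \<omega> * (x (Suc i) \<omega> - x i \<omega>)))
      = expectation (\<lambda>\<omega>. (m n \<omega>)\<^sup>2) + 4 * (\<Sum>i<n. expectation (\<lambda>\<omega>. m i \<omega> * (x (Suc i) \<omega> - x i \<omega>)))"
    using int_m2 int_drift
    by (subst Bochner_Integration.integral_add)
      (auto simp: Bochner_Integration.integral_sum intro!: Bochner_Integration.integrable_sum)
  moreover have "0 \<le> (\<Sum>i<n. expectation (\<lambda>\<omega>. m i \<omega> * (x (Suc i) \<omega> - x i \<omega>)))"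
    using drift by (intro sum_nonneg) auto
  moreover have "expectation (\<lambda>\<omega>. 4 * (x n \<omega>)\<^sup>2) \<le> 4 * exp (real n * \<theta>\<^sup>2 * c\<^sup>2 / 2)"
    unfolding x2 using E_expS[of n] by (simp add: mult_ac flip: exp_of_nat_mult)
  ultimately have m2: "expectation (\<lambda>\<omega>. (m n \<omega>)\<^sup>2) \<le> 4 * exp (real n * \<theta>\<^sup>2 * c\<^sup>2 / 2)"
    by linarith
  have le: "Max ((\<lambda>k. exp (\<theta> * S k \<omega>)) ` {..n}) \<le> (m n \<omega>)\<^sup>2" for \<omega>
  proof (subst Max_le_iff)
    show "\<forall>y\<in>(\<lambda>k. exp (\<theta> * S k \<omega>)) ` {..n}. y \<le> (m n \<omega>)\<^sup>2"
    proof safe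
      fix k assume "k \<le> n"
      then have "x k \<omega> \<le> m n \<omega>" by (simp add: m_def)
      then have "(x k \<omega>)\<^sup>2 \<le> (m n \<omega>)\<^sup>2" by (intro power_mono) (auto simp: x_def)
      then show "exp (\<theta> * S k \<omega>) \<le> (m n \<omega>)\<^sup>2"
        by (simp add: x_def power2_eq_square flip: exp_add)
    qed
  qed auto
  show int: "integrable M (\<lambda>\<omega>. Max ((\<lambda>k. exp (\<theta> * S k \<omega>)) ` {..n}))"
  proof (rule Bochner_Integration.integrable_bound[OF int_m2])
    show "(\<lambda>\<omega>. Max ((\<lambda>k. exp (\<theta> * S k \<omega>)) ` {..n})) \<in> borel_measurable M"
      using S_meas by (intro borel_measurable_Max) auto
    have "0 \<le> Max ((\<lambda>k. exp (\<theta> * S k \<omega>)) ` {..n})" for \<omega>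
      by (auto simp: Max_ge_iff intro!: bexI[of _ n])
    then show "AE \<omega> in M. norm (Max ((\<lambda>k. exp (\<theta> * S k \<omega>)) ` {..n})) \<le> norm ((m n \<omega>)\<^sup>2)"
      using le by (auto simp: abs_of_nonneg)
  qed
  have "expectation (\<lambda>\<omega>. Max ((\<lambda>k. exp (\<theta> * S k \<omega>)) ` {..n})) \<le> expectation (\<lambda>\<omega>. (m n \<omega>)\<^sup>2)"
    by (intro integral_mono int int_m2 le)
  with m2 show "expectation (\<lambda>\<omega>. Max ((\<lambda>k. exp (\<theta> * S k \<omega>)) ` {..n})) \<le> 4 * exp (real n * \<theta>\<^sup>2 * c\<^sup>2 / 2)"
    by linarith
qed

end

lemma exp_sum_le_sum_exp:
  fixes y :: "'i \<Rightarrow> real"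
  assumes "finite I" "I \<noteq> {}"
  shows "exp (\<Sum>i\<in>I. y i) \<le> (\<Sum>i\<in>I. exp (real (card I) * y i))"
proof -
  obtain k where k: "k \<in> I" "\<And>i. i \<in> I \<Longrightarrow> y i \<le> y k"
  proof -
    have "Max (y ` I) \<in> y ` I" using assms by simp
    then obtain k where "k \<in> I" "Max (y ` I) = y k" by auto
    then show thesis using that[of k] Max_ge[of "y ` I"] assms by auto
  qed
  have "exp (\<Sum>i\<in>I. y i) \<le> exp (real (card I) * y k)"
    using sum_bounded_above[of I y "y k"] k by simp
  also have "\<dots> \<le> (\<Sum>i\<in>I. exp (real (card I) * y i))"
    using member_le_sum[of k I "\<lambda>i. exp (real (card I) * y i)"] k assms by simp
  finally show ?thesis .
qed

text \<open>The bridge from one exponential moment to moments of arbitrary real order.\<close>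

lemma powr_le_exp:
  fixes x p :: real
  assumes "0 \<le> x" "0 < p"
  shows "x powr p \<le> p powr p * exp x"
proof -
  have "x / p \<le> exp (x / p)" using exp_ge_add_one_self[of "x / p"] by linarith
  then have "(x / p) powr p \<le> exp (x / p) powr p" using assms by (intro powr_mono2) auto
  also have "\<dots> = exp x" using assms by (simp add: powr_def)
  finally show ?thesis using assms by (simp add: powr_divide field_simps)
qed

context prob_space
begin

text \<open>The bound is stated through a random variable \<open>Q\<close> dominating the exponential of the normalised norms
  of all partial sums, so that \<open>ln Q\<close> is a bound for their maximum that has all moments. Splitting
  \<open>l1norm\<close> into the signed coordinates costs only a constant depending on the dimension.\<close>

lemma l1norm_maximal_inequality:
  fixes D :: "nat \<Rightarrow> 'a \<Rightarrow> real ^ 'd"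
  assumes ind: "indep_vars (\<lambda>_. borel) D {1..n}"
    and bd: "\<And>i \<omega>. i \<in> {1..n} \<Longrightarrow> l1norm (D i \<omega>) \<le> c" and c: "0 < c" and n: "0 < n"
    and E0: "\<And>i k. i \<in> {1..n} \<Longrightarrow> expectation (\<lambda>\<omega>. D i \<omega> $ k) = 0"
  obtains Q where "integrable M Q"
    "expectation Q \<le> 8 * real CARD('d) * exp ((real CARD('d))\<^sup>2 / 2)"
    "\<And>\<omega> j. j \<le> n \<Longrightarrow> exp (l1norm (\<Sum>i=1..j. D i \<omega>) / (c * sqrt n)) \<le> Q \<omega>"
proof -
  define d where "d = real CARD('d)"
  \<comment> \<open>The factor \<open>d\<close> comes from \<open>exp_sum_le_sum_exp\<close>; with this \<open>\<theta>\<close> the Hoeffding exponent does not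
    depend on \<open>n\<close> and \<open>c\<close>.\<close>
  define \<theta> where "\<theta> = d / (c * sqrt n)"
  have d: "0 < d" by (simp add: d_def)
  have \<theta>: "0 < \<theta>" using d c n by (simp add: \<theta>_def)
  have \<theta>2: "real n * \<theta>\<^sup>2 * c\<^sup>2 / 2 = d\<^sup>2 / 2"
    using c n by (simp add: \<theta>_def power_divide power_mult_distrib)
  define P where "P \<sigma> k \<omega> = Max ((\<lambda>j. exp (\<theta> * (\<Sum>i=1..j. \<sigma> * D i \<omega> $ k))) ` {..n})" for \<sigma> k \<omega>
  have P: "integrable M (P \<sigma> k) \<and> expectation (P \<sigma> k) \<le> 4 * exp (d\<^sup>2 / 2)" if \<sigma>: "\<sigma> \<in> {1, -1}" for \<sigma> k
  proof -
    have "indep_vars (\<lambda>_. borel) (\<lambda>i \<omega>. \<sigma> * D i \<omega> $ k) {1..n}"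
      by (rule indep_vars_compose2[OF ind, where Y = "\<lambda>_ x. \<sigma> * x $ k"])
        (intro borel_measurable_continuous_onI continuous_intros)
    moreover have "\<bar>\<sigma> * D i \<omega> $ k\<bar> \<le> c" if "i \<in> {1..n}" for i \<omega>
      using order_trans[OF component_le_l1norm bd[OF that]] \<sigma> by (auto simp: abs_mult)
    moreover have "expectation (\<lambda>\<omega>. \<sigma> * D i \<omega> $ k) = 0" if "i \<in> {1..n}" for i
      using E0[OF that] by simp
    ultimately show ?thesis
      using exp_maximal_inequality[of "\<lambda>i \<omega>. \<sigma> * D i \<omega> $ k" n c \<theta>] c \<theta>
      unfolding P_def \<theta>2 by (auto simp: less_imp_le)
  qed
  define Q where "Q \<omega> = (\<Sum>k\<in>UNIV. P 1 k \<omega> + P (-1) k \<omega>)" for \<omega>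
  show thesis
  proof
    show "integrable M Q"
      unfolding Q_def using P by (intro Bochner_Integration.integrable_sum Bochner_Integration.integrable_add) auto
    have "expectation Q = (\<Sum>k\<in>UNIV. expectation (P 1 k) + expectation (P (-1) k))"
      unfolding Q_def using P by (subst Bochner_Integration.integral_sum) auto
    also have "\<dots> \<le> (\<Sum>k\<in>(UNIV :: 'd set). 4 * exp (d\<^sup>2 / 2) + 4 * exp (d\<^sup>2 / 2))"
      using P by (intro sum_mono add_mono) auto
    finally show "expectation Q \<le> 8 * real CARD('d) * exp ((real CARD('d))\<^sup>2 / 2)"
      by (simp add: d_def)
    fix \<omega> j assume j: "j \<le> n"
    define S where "S = (\<Sum>i=1..j. D i \<omega>)"
    have le: "exp (\<theta> * (\<sigma> * S $ k)) \<le> P \<sigma> k \<omega>" for \<sigma> k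
      unfolding P_def S_def sum_component sum_distrib_left[of \<sigma>] using j by (intro Max_ge) auto
    have "exp (l1norm S / (c * sqrt n)) = exp (\<Sum>k\<in>UNIV. \<bar>S $ k\<bar> / (c * sqrt n))"
      by (simp add: l1norm_def sum_divide_distrib)
    also have "\<dots> \<le> (\<Sum>k\<in>UNIV. exp (d * (\<bar>S $ k\<bar> / (c * sqrt n))))"
      unfolding d_def by (rule exp_sum_le_sum_exp) auto
    also have "\<dots> \<le> Q \<omega>"
      unfolding Q_def
    proof (rule sum_mono)
      fix k
      have "exp (d * (\<bar>S $ k\<bar> / (c * sqrt n))) = exp (\<theta> * \<bar>S $ k\<bar>)" by (simp add: \<theta>_def)
      also have "\<dots> \<le> exp (\<theta> * (1 * S $ k)) + exp (\<theta> * (- 1 * S $ k))"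
        by (cases "0 \<le> S $ k") (auto simp: abs_if)
      also have "\<dots> \<le> P 1 k \<omega> + P (- 1) k \<omega>" by (intro add_mono le)
      finally show "exp (d * (\<bar>S $ k\<bar> / (c * sqrt n))) \<le> P 1 k \<omega> + P (- 1) k \<omega>" .
    qed
    finally show "exp (l1norm (\<Sum>i=1..j. D i \<omega>) / (c * sqrt n)) \<le> Q \<omega>" by (simp add: S_def)
  qed
qed

end

section \<open>The quadrature errors as random variables\<close>

context prob_space
begin

lemma expectation_uniform01:
  fixes g :: "real \<Rightarrow> real"
  assumes u: "distr M borel \<tau> = uniform_measure lborel {0..1}"
    and [measurable]: "\<tau> \<in> borel_measurable M" "g \<in> borel_measurable borel"
  shows "expectation (\<lambda>\<omega>. g (\<tau> \<omega>)) = (\<integral>x. indicator {0..1} x *\<^sub>R g x \<partial>lborel)"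
proof -
  have "expectation (\<lambda>\<omega>. g (\<tau> \<omega>)) = (\<integral>x. g x \<partial>distr M borel \<tau>)"
    by (subst integral_distr) auto
  also have "distr M borel \<tau> = density lborel (\<lambda>x. ennreal (indicator {0..1} x))"
    unfolding u uniform_measure_def by (simp add: ennreal_indicator divide_ennreal_def)
  also have "(\<integral>x. g x \<partial>density lborel (\<lambda>x. ennreal (indicator {0..1} x))) = (\<integral>x. indicator {0..1} x *\<^sub>R g x \<partial>lborel)"
    by (subst integral_density) auto
  finally show ?thesis .
qed

lemma AE_uniform01:
  assumes u: "distr M borel \<tau> = uniform_measure lborel {0..1::real}"
    and [measurable]: "\<tau> \<in> borel_measurable M"
  shows "AE \<omega> in M. \<tau> \<omega> \<in> {0..1}"
proof -
  have "AE x in distr M borel \<tau>. x \<in> {0..1}"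
    unfolding u by (intro AE_uniform_measureI) auto
  then show ?thesis by (subst (asm) AE_distr_iff) auto
qed

end

text \<open>A variable that is uniformly distributed on \<open>[0,1]\<close> may leave this interval on a null set, where
  nothing is known about the right-hand side. Clamping makes the quadrature errors bounded and continuous
  functions of the variable everywhere.\<close>

definition clamp01 :: "real \<Rightarrow> real" where
  "clamp01 x = max 0 (min 1 x)"

lemma clamp01_in [simp]: "0 \<le> clamp01 x" "clamp01 x \<le> 1"
  by (auto simp: clamp01_def)

lemma clamp01_id: "x \<in> {0..1} \<Longrightarrow> clamp01 x = x"
  by (auto simp: clamp01_def)

context perturbed_ivp
begin

lemma z_deriv: "t \<in> {a..b} \<Longrightarrow> (z has_vector_derivative f t (z t)) (at t within {a..b})"
  using z by (auto simp: solves_ivp_def)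

lemma continuous_z: "continuous_on {a..b} z"
  by (auto simp: continuous_on_eq_continuous_within intro: has_vector_derivative_continuous z_deriv)

lemma continuous_quad_err:
  assumes cont: "continuous_on {a..b} (\<lambda>t. f t (z t))" and j: "j < n"
  shows "continuous_on UNIV (\<lambda>x. quad_err (\<lambda>_. clamp01 x) j)"
proof -
  have "continuous_on UNIV (\<lambda>x. node a b n j + clamp01 x * h)"
    unfolding clamp01_def by (intro continuous_intros)
  moreover have "range (\<lambda>x. node a b n j + clamp01 x * h) \<subseteq> {a..b}"
    unfolding h_def by (intro image_subsetI node_add_in_interval[OF ab j] clamp01_in)
  ultimately have "continuous_on UNIV (\<lambda>x. (\<lambda>t. f t (z t)) (node a b n j + clamp01 x * h))"
    by (rule continuous_on_compose2[OF cont])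
  then show ?thesis unfolding quad_err_def by (intro continuous_intros)
qed

text \<open>Unbiasedness of the randomized quadrature: on \<open>[0,1]\<close>, \<open>quad_err\<close> is the derivative of
  \<open>x * (z (t + h) - z t) - z (t + x * h)\<close>, a function with equal values at \<open>0\<close> and \<open>1\<close>.\<close>

lemma integral_quad_err:
  assumes cont: "continuous_on {a..b} (\<lambda>t. f t (z t))" and j: "j < n"
  shows "(\<integral>x. indicator {0..1} x *\<^sub>R (quad_err (\<lambda>_. clamp01 x) j $ k) \<partial>lborel) = 0"
proof -
  define t where "t = node a b n j"
  define F where "F x = x * ((z (t + h) - z t) $ k) - z (t + x * h) $ k" for x
  have nS: "node a b n (Suc j) = t + h" by (simp add: node_Suc t_def h_def)
  have "(\<integral>x. indicator {0..1} x *\<^sub>R (quad_err (\<lambda>_. clamp01 x) j $ k) \<partial>lborel) = F 1 - F 0"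
  proof (rule integral_FTC_Icc)
    fix x :: real assume x: "0 \<le> x" "x \<le> 1"
    then have tx: "t + y * h \<in> {a..b}" if "y \<in> {0..1}" for y
      using node_add_in_interval[OF ab j, of y] that by (simp add: t_def h_def)
    have "(z \<circ> (\<lambda>x. t + x * h) has_vector_derivative h *\<^sub>R f (t + x * h) (z (t + x * h))) (at x within {0..1})"
    proof (rule vector_diff_chain_within)
      show "((\<lambda>x. t + x * h) has_vector_derivative h) (at x within {0..1})"
        by (auto intro!: derivative_eq_intros)
      show "(z has_vector_derivative f (t + x * h) (z (t + x * h))) (at (t + x * h) within (\<lambda>x. t + x * h) ` {0..1})"
        by (rule has_vector_derivative_within_subset[OF z_deriv]) (use tx x in auto)
    qed
    from bounded_linear.has_vector_derivative[OF bounded_linear_vec_nth this, of k]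
    have "((\<lambda>x. z (t + x * h) $ k) has_vector_derivative h * f (t + x * h) (z (t + x * h)) $ k) (at x within {0..1})"
      by (simp add: comp_def)
    then have "(F has_vector_derivative (z (t + h) - z t) $ k - h * f (t + x * h) (z (t + x * h)) $ k) (at x within {0..1})"
      unfolding F_def by (auto intro!: derivative_eq_intros)
    then show "(F has_vector_derivative quad_err (\<lambda>_. clamp01 x) j $ k) (at x within {0..1})"
      using x by (simp add: quad_err_def nS t_def[symmetric] clamp01_id)
  next
    show "continuous_on {0..1} (\<lambda>x. quad_err (\<lambda>_. clamp01 x) j $ k)"
      by (intro continuous_intros continuous_on_subset[OF continuous_quad_err[OF cont j]]) auto
  qed simp
  also have "\<dots> = 0" by (simp add: F_def)
  finally show ?thesis .
qed

lemma quad_err_maximal_inequality: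
  fixes M :: "'w measure"
  assumes M: "prob_space M" and iid: "iid_uniform01 M \<tau>"
    and cont: "continuous_on {a..b} (\<lambda>t. f t (z t))" and \<kappa>0: "0 < \<kappa>"
  obtains Q where "integrable M Q"
    "integral\<^sup>L M Q \<le> 8 * real CARD('d) * exp ((real CARD('d))\<^sup>2 / 2)"
    "\<And>\<omega> j. j \<le> n \<Longrightarrow>
      exp (l1norm (\<Sum>i<j. quad_err (\<lambda>i. clamp01 (\<tau> i \<omega>)) i) / (\<kappa> * h * sqrt n)) \<le> Q \<omega>"
proof -
  interpret prob_space M by fact
  define D where "D i \<omega> = quad_err (\<lambda>_. clamp01 (\<tau> i \<omega>)) (i - 1)" for i \<omega>
  have meas: "(\<lambda>x. quad_err (\<lambda>_. clamp01 x) (i - 1)) \<in> borel_measurable borel" if "i \<in> {1..n}" for i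
    using that by (intro borel_measurable_continuous_onI continuous_quad_err cont) auto
  have ind\<tau>: "indep_vars (\<lambda>_. borel) \<tau> {1..n}"
    using iid by (auto simp: iid_uniform01_def intro: indep_vars_subset)
  have \<tau>: "\<tau> i \<in> borel_measurable M" "distr M borel (\<tau> i) = uniform_measure lborel {0..1}"
    if "i \<in> {1..n}" for i
    using ind\<tau> iid that by (auto simp: indep_vars_def iid_uniform01_def)
  have 1: "indep_vars (\<lambda>_. borel) D {1..n}"
    unfolding D_def by (rule indep_vars_compose2[OF ind\<tau>]) (rule meas)
  have 2: "l1norm (D i \<omega>) \<le> \<kappa> * h" if "i \<in> {1..n}" for i \<omega>
    unfolding D_def using that by (intro quad_err_le) auto
  have 3: "expectation (\<lambda>\<omega>. D i \<omega> $ k) = 0" if i: "i \<in> {1..n}" for i k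
  proof -
    have "(\<lambda>x. quad_err (\<lambda>_. clamp01 x) (i - 1) $ k) \<in> borel_measurable borel"
      using i by (intro borel_measurable_continuous_onI continuous_intros continuous_quad_err cont) auto
    from expectation_uniform01[OF \<tau>(2)[OF i] \<tau>(1)[OF i] this]
    show ?thesis unfolding D_def
      using i by (subst integral_quad_err[symmetric, OF cont, of "i - 1" k]) auto
  qed
  have "0 < \<kappa> * h" using \<kappa>0 step_size(1) by simp
  from l1norm_maximal_inequality[OF 1 2 this n 3] obtain Q where Q: "integrable M Q"
    "expectation Q \<le> 8 * real CARD('d) * exp ((real CARD('d))\<^sup>2 / 2)"
    "\<And>\<omega> j. j \<le> n \<Longrightarrow> exp (l1norm (\<Sum>i=1..j. D i \<omega>) / (\<kappa> * h * sqrt n)) \<le> Q \<omega>"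
    by blast
  have "(\<Sum>i=1..j. D i \<omega>) = (\<Sum>i<j. quad_err (\<lambda>i. clamp01 (\<tau> i \<omega>)) i)" for j \<omega>
    by (simp add: sum.atLeast1_atMost_eq D_def quad_err_def)
  with Q that show thesis by auto
qed

end

section \<open>Measurability of the error\<close>

lemma (in complete_measure) borel_measurable_AE_eq:
  fixes f g :: "'a \<Rightarrow> real"
  assumes f: "f \<in> borel_measurable M" and eq: "AE x in M. f x = g x"
  shows "g \<in> borel_measurable M"
  unfolding borel_measurable_iff_le
proof
  fix c
  have 1: "{x \<in> space M. f x \<le> c} \<in> sets M" using f by measurable
  have 2: "AE x in M. x \<in> {x \<in> space M. f x \<le> c} \<longleftrightarrow> x \<in> {x \<in> space M. g x \<le> c}"
    using eq by eventually_elim auto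
  show "{x \<in> space M. g x \<le> c} \<in> sets M" by (rule in_sets_AE[OF 2 1]) auto
qed

lemma rk2_cong:
  assumes "a < b" and s: "\<And>j. 1 \<le> j \<Longrightarrow> j \<le> n \<Longrightarrow> s j \<in> {0..1}"
    and eq: "\<And>t x. t \<in> {a..b} \<Longrightarrow> F t x = f t x" and "j \<le> n"
  shows "rk2 a b n \<eta> F s j = rk2 a b n \<eta> f s j"
  using \<open>j \<le> n\<close>
proof (induction j)
  case (Suc j)
  then have sj: "0 \<le> s (Suc j)" "s (Suc j) \<le> 1" and j: "j < n" using s[of "Suc j"] by auto
  have IH: "rk2 a b n \<eta> F s j = rk2 a b n \<eta> f s j" using Suc by simp
  show ?case
    using eq node_add_in_interval[OF \<open>a < b\<close> j sj] node_add_in_interval[OF \<open>a < b\<close> j, of 0]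
    unfolding rk2_Suc rk2_stage_def IH by simp
qed simp

text \<open>As long as the random variables take values in \<open>[0,1]\<close>, only values of the right-hand side at times in
  \<open>[a,b]\<close> enter.\<close>

lemma rk2_interp_cong:
  assumes "a < b" "0 < n" and s: "\<And>j. 1 \<le> j \<Longrightarrow> j \<le> n \<Longrightarrow> s j \<in> {0..1}"
    and eq: "\<And>t x. t \<in> {a..b} \<Longrightarrow> F t x = f t x" and t: "t \<in> {a..b}"
  shows "rk2_interp a b n \<eta> F s t = rk2_interp a b n \<eta> f s t"
proof -
  obtain j where j: "j < n" "t \<in> {node a b n j..node a b n (Suc j)}"
    using piece_exists[OF assms(1,2) t] .
  have "rk2 a b n \<eta> F s i = rk2 a b n \<eta> f s i" if "i \<le> n" for i
    by (rule rk2_cong[OF assms(1) s eq that])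
  from this[of j] this[of "Suc j"] j(1) show ?thesis
    unfolding rk2_interp_on_piece[OF assms(1,2) j(2)] by simp
qed

lemma continuous_rk2_interp:
  assumes "a < b" "0 < n"
  shows "continuous_on {a..b} (rk2_interp a b n \<eta> f s)"
proof -
  define I where "I j = {node a b n j..node a b n (Suc j)}" for j
  have "continuous_on (\<Union>j\<in>{..<n}. I j) (rk2_interp a b n \<eta> f s)"
  proof (rule continuous_on_closed_Union)
    fix j assume "j \<in> {..<n}"
    have "node a b n (Suc j) - node a b n j \<noteq> 0" using assms by (simp add: node_Suc)
    then have "continuous_on (I j) (\<lambda>t. ((t - node a b n j) / (node a b n (Suc j) - node a b n j)) *\<^sub>R
      (rk2 a b n \<eta> f s (Suc j) - rk2 a b n \<eta> f s j) + rk2 a b n \<eta> f s j)"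
      by (intro continuous_intros) auto
    then show "continuous_on (I j) (rk2_interp a b n \<eta> f s)"
      by (rule continuous_on_eq) (simp only: I_def rk2_interp_on_piece[OF assms])
  qed (auto simp: I_def)
  moreover have "{a..b} \<subseteq> (\<Union>j\<in>{..<n}. I j)"
    using piece_exists[OF assms] unfolding I_def by blast
  ultimately show ?thesis by (rule continuous_on_subset)
qed

lemma borel_measurable_rk2:
  fixes F :: "real \<Rightarrow> real ^ 'd \<Rightarrow> real ^ 'd"
  assumes F: "(\<lambda>(t, x). F t x) \<in> borel_measurable borel"
    and \<tau>: "\<And>j. 1 \<le> j \<Longrightarrow> \<tau> j \<in> borel_measurable M"
  shows "(\<lambda>\<omega>. rk2 a b n \<eta> F (\<lambda>j. \<tau> j \<omega>) j) \<in> borel_measurable M"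
proof (induction j)
  case (Suc j)
  have F2: "(\<lambda>\<omega>. F (u \<omega>) (v \<omega>)) \<in> borel_measurable M"
    if "u \<in> borel_measurable M" "v \<in> borel_measurable M" for u v
    using measurable_compose[OF borel_measurable_Pair[OF that] F] by simp
  show ?case unfolding rk2_Suc rk2_stage_def
    using Suc \<tau>[of "Suc j"]
    by (intro borel_measurable_add borel_measurable_scaleR F2 borel_measurable_times) auto
qed simp

text \<open>By continuity in \<open>t\<close>, the supremum may be taken over a countable dense set of times.\<close>

lemma borel_measurable_sup_error:
  fixes F :: "real \<Rightarrow> real ^ 'd \<Rightarrow> real ^ 'd"
  assumes ab: "a < b" and n: "0 < n" and F: "(\<lambda>(t, x). F t x) \<in> borel_measurable borel"
    and \<tau>: "\<And>j. 1 \<le> j \<Longrightarrow> \<tau> j \<in> borel_measurable M"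
    and z: "continuous_on {a..b} z"
  shows "(\<lambda>\<omega>. sup_error a b z (rk2_interp a b n \<eta> F (\<lambda>j. \<tau> j \<omega>))) \<in> borel_measurable M"
proof -
  define g where "g \<omega> t = l1norm (z t - rk2_interp a b n \<eta> F (\<lambda>j. \<tau> j \<omega>) t)" for \<omega> t
  have g: "continuous_on {a..b} (g \<omega>)" for \<omega>
    unfolding g_def by (intro continuous_intros z continuous_rk2_interp ab n)
  have bdd: "bdd_above (g \<omega> ` {a..b})" for \<omega>
    by (intro bounded_imp_bdd_above compact_imp_bounded compact_continuous_image g compact_Icc)
  obtain S :: "real set" where S: "countable S" "S \<subseteq> {a..b}" "{a..b} \<subseteq> closure S"
    using separable[of "{a..b}"] by blast
  have clS: "closure S = {a..b}" using S closure_minimal[OF S(2)] by auto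
  have ne: "S \<noteq> {}" using clS ab by auto
  have bddS: "bdd_above (g \<omega> ` S)" for \<omega> by (rule bdd_above_mono[OF bdd]) (use S in auto)
  have "(SUP t\<in>{a..b}. g \<omega> t) = (SUP t\<in>S. g \<omega> t)" for \<omega>
  proof (rule antisym)
    show "(SUP t\<in>S. g \<omega> t) \<le> (SUP t\<in>{a..b}. g \<omega> t)"
      using ne S by (intro cSUP_subset_mono bdd) auto
    have "g \<omega> t \<le> (SUP t\<in>S. g \<omega> t)" if "t \<in> {a..b}" for t
    proof (rule continuous_le_on_closure[where S = S and f = "g \<omega>"])
      show "continuous_on (closure S) (g \<omega>)" using g clS by simp
      show "g \<omega> x \<le> (SUP t\<in>S. g \<omega> t)" if "x \<in> S" for x by (rule cSUP_upper[OF that bddS])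
    qed (use that clS in auto)
    then show "(SUP t\<in>{a..b}. g \<omega> t) \<le> (SUP t\<in>S. g \<omega> t)"
      using ab by (intro cSUP_least) auto
  qed
  then have "(\<lambda>\<omega>. sup_error a b z (rk2_interp a b n \<eta> F (\<lambda>j. \<tau> j \<omega>))) = (\<lambda>\<omega>. SUP t\<in>S. g \<omega> t)"
    by (simp add: sup_error_def g_def fun_eq_iff)
  also have "\<dots> \<in> borel_measurable M"
  proof (rule borel_measurable_cSUP[OF S(1)])
    fix t
    have "(\<lambda>\<omega>. rk2_interp a b n \<eta> F (\<lambda>j. \<tau> j \<omega>) t) \<in> borel_measurable M"
      unfolding rk2_interp_def Let_def
      by (intro borel_measurable_add borel_measurable_scaleR borel_measurable_diff
          borel_measurable_rk2[OF F \<tau>] borel_measurable_const)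
    then show "(\<lambda>\<omega>. g \<omega> t) \<in> borel_measurable M" unfolding g_def by measurable
  qed (rule bddS)
  finally show ?thesis .
qed

lemma noisy_data_borel_extension:
  fixes f :: "real \<Rightarrow> real ^ 'd \<Rightarrow> real ^ 'd"
  assumes f: "continuous_on ({a..b} \<times> UNIV) (\<lambda>(t, x). f t x)"
    and f': "(\<eta>', f') \<in> noisy_data a b \<eta> f \<delta>"
  obtains F where "(\<lambda>(t, x). F t x) \<in> borel_measurable borel"
    "\<And>t x. t \<in> {a..b} \<Longrightarrow> F t x = f' t x"
proof -
  obtain df where df: "(\<lambda>(t, y). df t y) \<in> borel_measurable (restrict_space borel ({a..b} \<times> UNIV))"
    and eq: "\<forall>t\<in>{a..b}. \<forall>y. f' t y = f t y + df t y"
    using f' unfolding noisy_data_def by auto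
  have "(\<lambda>p. (case p of (t, y) \<Rightarrow> f t y) + (case p of (t, y) \<Rightarrow> df t y))
      \<in> borel_measurable (restrict_space borel ({a..b} \<times> UNIV))"
    by (intro borel_measurable_add df borel_measurable_continuous_on_restrict f)
  moreover have "closed ({a..b} \<times> (UNIV :: (real ^ 'd) set))" by (intro closed_Times) auto
  then have "{a..b} \<times> UNIV \<inter> space borel \<in> sets (borel :: (real \<times> (real ^ 'd)) measure)" by simp
  ultimately have "(\<lambda>p. if p \<in> {a..b} \<times> UNIV then (case p of (t, y) \<Rightarrow> f t y) + (case p of (t, y) \<Rightarrow> df t y) else 0)
      \<in> borel_measurable borel"
    by (subst measurable_restrict_space_iff[symmetric]) auto
  also have "(\<lambda>p. if p \<in> {a..b} \<times> UNIV then (case p of (t, y) \<Rightarrow> f t y) + (case p of (t, y) \<Rightarrow> df t y) else 0)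
      = (\<lambda>(t, y). if t \<in> {a..b} then f t y + df t y else 0)" by auto
  finally show thesis using eq by (intro that[of "\<lambda>t y. if t \<in> {a..b} then f t y + df t y else 0"]) auto
qed

section \<open>Moments of the error\<close>

text \<open>Since \<open>(1 + ln Q)\<^sup>p \<le> p\<^sup>p * exp (1 + ln Q)\<close>, the \<open>p\<close>-th moment is controlled by the mean of \<open>Q\<close>. The
  resulting bound is linear in the scale \<open>G\<close>.\<close>

lemma (in prob_space) Lp_norm_le_of_log_bound:
  assumes X: "X \<in> borel_measurable M" and p: "0 < p" and G: "0 < G"
    and Q: "integrable M Q" "expectation Q \<le> q" "\<And>\<omega>. 1 \<le> Q \<omega>"
    and bd: "AE \<omega> in M. \<bar>X \<omega>\<bar> \<le> G * (1 + ln (Q \<omega>))"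
  shows "integrable M (\<lambda>\<omega>. \<bar>X \<omega>\<bar> powr p)"
    and "Lp_norm M p X \<le> (p powr p * exp 1 * q) powr (1 / p) * G"
proof -
  define B where "B = G powr p * (p powr p * exp 1)"
  have B: "0 \<le> B" by (simp add: B_def)
  have le: "AE \<omega> in M. \<bar>X \<omega>\<bar> powr p \<le> B * Q \<omega>"
    using bd
  proof eventually_elim
    case (elim \<omega>)
    have ln: "0 \<le> ln (Q \<omega>)" using Q(3) by simp
    have "\<bar>X \<omega>\<bar> powr p \<le> (G * (1 + ln (Q \<omega>))) powr p" using elim p by (intro powr_mono2) auto
    also have "\<dots> = G powr p * (1 + ln (Q \<omega>)) powr p" using G ln by (simp add: powr_mult)
    also have "\<dots> \<le> G powr p * (p powr p * exp (1 + ln (Q \<omega>)))"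
      using ln p by (intro mult_left_mono powr_le_exp) auto
    also have "exp (1 + ln (Q \<omega>)) = exp 1 * Q \<omega>"
      using Q(3)[of \<omega>] by (simp add: exp_add)
    finally show ?case by (simp add: B_def mult_ac)
  qed
  have intB: "integrable M (\<lambda>\<omega>. B * Q \<omega>)" using Q(1) by simp
  show int: "integrable M (\<lambda>\<omega>. \<bar>X \<omega>\<bar> powr p)"
  proof (rule Bochner_Integration.integrable_bound[OF intB])
    show "(\<lambda>\<omega>. \<bar>X \<omega>\<bar> powr p) \<in> borel_measurable M" using X by measurable
    show "AE \<omega> in M. norm (\<bar>X \<omega>\<bar> powr p) \<le> norm (B * Q \<omega>)"
      using le by eventually_elim simp
  qed
  have "expectation (\<lambda>\<omega>. \<bar>X \<omega>\<bar> powr p) \<le> expectation (\<lambda>\<omega>. B * Q \<omega>)"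
    by (intro integral_mono_AE int intB le)
  also have "\<dots> \<le> B * q" using Q(2) B by (simp add: mult_left_mono)
  finally have "Lp_norm M p X \<le> (B * q) powr (1 / p)"
    unfolding Lp_norm_def using p by (intro powr_mono2 integral_nonneg_AE) auto
  also have "(B * q) powr (1 / p) = (G powr p) powr (1 / p) * (p powr p * exp 1 * q) powr (1 / p)"
    unfolding B_def mult.assoc[of "G powr p"] by (rule powr_mult)
  also have "(G powr p) powr (1 / p) = G" using p G by (simp add: powr_powr)
  finally show "Lp_norm M p X \<le> (p powr p * exp 1 * q) powr (1 / p) * G"
    by (simp only: mult.commute)
qed

text \<open>For step sizes at most \<open>1\<close>, \<open>z'\<close> varies over one step by at most a constant times \<open>h\<^sup>\<rho>\<close>: by the Hoelder
  condition in \<open>t\<close>, and by the Lipschitz condition in \<open>x\<close> because \<open>z\<close> itself is Lipschitz continuous and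
  \<open>h \<le> h\<^sup>\<rho>\<close>.\<close>

lemma perturbed_ivp_Fclass:
  fixes f :: "real \<Rightarrow> real ^ 'd \<Rightarrow> real ^ 'd"
  assumes "a < b" "0 < \<rho>" "\<rho> \<le> 1" "0 < K" "0 < L" "0 \<le> \<delta>"
    and F: "(\<eta>, f) \<in> Fclass a b \<rho> K L" and noisy: "(\<eta>', f') \<in> noisy_data a b \<eta> f \<delta>"
    and z: "solves_ivp a b \<eta> f z" and n: "0 < n" "(b - a) / real n \<le> 1"
  shows "perturbed_ivp a b L \<delta> (L * (1 + K * ((1 + K) * exp (K * (b - a)))) * ((b - a) / real n) powr \<rho>)
    n (l1ball \<eta> (Rbar a b K)) \<eta> \<eta>' f f' z"
proof
  define M0 where "M0 = K * ((1 + K) * exp (K * (b - a)))"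
  have M0: "0 < M0" using \<open>0 < K\<close> by (simp add: M0_def)
  have \<eta>: "l1norm \<eta> \<le> K"
    and growth: "\<And>t x. t \<in> {a..b} \<Longrightarrow> l1norm (f t x) \<le> K * (1 + l1norm x)"
    and holder: "\<And>t s x. t \<in> {a..b} \<Longrightarrow> s \<in> {a..b} \<Longrightarrow> x \<in> l1ball \<eta> (Rbar a b K) \<Longrightarrow>
      l1norm (f t x - f s x) \<le> L * \<bar>t - s\<bar> powr \<rho>"
    and lip: "\<And>t x y. t \<in> {a..b} \<Longrightarrow> x \<in> l1ball \<eta> (Rbar a b K) \<Longrightarrow> y \<in> l1ball \<eta> (Rbar a b K) \<Longrightarrow>
      l1norm (f t x - f t y) \<le> L * l1norm (x - y)"
    using F unfolding Fclass_def by auto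
  show ball: "z t \<in> l1ball \<eta> (Rbar a b K)" if "t \<in> {a..b}" for t
    by (rule solution_in_l1ball[OF assms(1) z assms(4) \<eta> growth that])
  show "l1norm (f t x - f t y) \<le> L * l1norm (x - y)"
    if "t \<in> {a..b}" "x \<in> l1ball \<eta> (Rbar a b K)" "y \<in> l1ball \<eta> (Rbar a b K)" for t x y
    by (rule lip[OF that])
  have f_le: "l1norm (f t (z t)) \<le> M0" if t: "t \<in> {a..b}" for t
  proof -
    have "1 + l1norm (z t) \<le> (1 + K) * exp (K * (t - a))"
      by (rule solves_ivp_growth[OF z assms(4) \<eta> growth t])
    also have "\<dots> \<le> (1 + K) * exp (K * (b - a))" using t \<open>0 < K\<close> by auto
    finally have "K * (1 + l1norm (z t)) \<le> M0" using \<open>0 < K\<close> by (simp add: M0_def)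
    then show ?thesis using growth[OF t, of "z t"] by linarith
  qed
  have z_lip: "l1norm (z r - z t) \<le> M0 * (r - t)" if "t \<in> {a..b}" "r \<in> {a..b}" "t \<le> r" for t r
  proof -
    have "l1norm (z r - z t) \<le> M0 * r - M0 * t"
    proof (rule l1norm_mean_value[where z' = "\<lambda>u. f u (z u)" and \<phi> = "\<lambda>u. M0 * u" and \<phi>' = "\<lambda>_. M0"])
      fix u assume u: "u \<in> {t..r}"
      show "(z has_vector_derivative f u (z u)) (at u within {t..r})"
        by (rule has_vector_derivative_within_subset[of _ _ _ "{a..b}"])
          (use z u that in \<open>auto simp: solves_ivp_def\<close>)
      show "l1norm (f u (z u)) \<le> M0" using u that by (intro f_le) auto
      show "((\<lambda>u. M0 * u) has_real_derivative M0) (at u within {t..r})"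
        by (auto intro!: derivative_eq_intros)
    qed (rule that)
    then show ?thesis by (simp add: algebra_simps)
  qed
  fix t r assume t: "t \<in> {a..b}" and r: "r \<in> {a..b}" and tr: "\<bar>r - t\<bar> \<le> (b - a) / real n"
  define h where "h = (b - a) / real n"
  have h: "0 < h" "h \<le> 1" using assms by (auto simp: h_def)
  have "h powr 1 \<le> h powr \<rho>" using h assms by (intro powr_mono') auto
  then have hh: "h \<le> h powr \<rho>" using h by simp
  have "l1norm (z r - z t) \<le> M0 * \<bar>r - t\<bar>"
    using z_lip[OF t r] z_lip[OF r t] by (cases "t \<le> r") (auto simp: l1norm_commute)
  also have "\<dots> \<le> M0 * h powr \<rho>" using tr hh M0 by (intro mult_left_mono) (auto simp: h_def)
  finally have "l1norm (f t (z r) - f t (z t)) \<le> L * (M0 * h powr \<rho>)"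
    using order_trans[OF lip[OF t ball[OF r] ball[OF t]] mult_left_mono] \<open>0 < L\<close> by simp
  moreover have "\<bar>r - t\<bar> powr \<rho> \<le> h powr \<rho>"
    using tr \<open>0 < \<rho>\<close> by (intro powr_mono2) (auto simp: h_def)
  then have "l1norm (f r (z r) - f t (z r)) \<le> L * h powr \<rho>"
    using holder[OF r t ball[OF r]] \<open>0 < L\<close> mult_left_mono[of "\<bar>r - t\<bar> powr \<rho>" "h powr \<rho>" L] by linarith
  ultimately show "l1norm (f r (z r) - f t (z t)) \<le> L * (1 + K * ((1 + K) * exp (K * (b - a)))) * ((b - a) / real n) powr \<rho>"
    using l1norm_triangle[of "f r (z r) - f t (z r)" "f t (z r) - f t (z t)"]
    unfolding M0_def[symmetric] h_def[symmetric] by (simp add: algebra_simps)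
next
  show "l1norm (f t x - f' t x) \<le> \<delta>" if "t \<in> {a..b}" for t x
    using noisy that by (auto simp: noisy_data_def)
  show "l1norm (\<eta> - \<eta>') \<le> \<delta>"
    using noisy by (auto simp: noisy_data_def l1ball_def l1norm_commute)
qed (use assms in auto)

text \<open>Collects the pathwise bound with \<open>\<kappa>\<close> of order \<open>h\<^sup>\<rho>\<close> and partial sums of size \<open>\<kappa> * h * sqrt N * q\<close>. The
  rate comes from \<open>h\<^sup>\<rho> * h * sqrt N = sqrt T * h\<^sup>\<rho>\<^sup>+\<^sup>1\<^sup>/\<^sup>2\<close>, while the other terms are of order \<open>h\<^sup>\<rho>\<^sup>+\<^sup>1\<close> or \<open>\<delta>\<close>.\<close>

lemma error_terms_le:
  fixes T L L1 h \<delta> q :: real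
  assumes pos: "0 < T" "0 < L" "0 < L1" "0 < h" "0 \<le> \<delta>" "0 \<le> q" "0 < \<rho>"
    and h1: "h \<le> 1" and hN: "h * N = T"
  defines "\<kappa> \<equiv> L1 * h powr \<rho>"
  shows "(\<delta> + \<kappa> * h * sqrt N * q + T * (L * (\<kappa> * h + h * \<delta>) + \<delta>)) * exp (T * L * (1 + h * L)) + 2 * \<kappa> * h
    \<le> ((1 + L1 * sqrt T + T * (L * L1 + L + 1)) * exp (T * L * (1 + L)) + 2 * L1)
        * (h powr (\<rho> + 1 / 2) + \<delta>) * (1 + q)"
proof -
  define w where "w = h powr (\<rho> + 1 / 2)"
  define H where "H = (w + \<delta>) * (1 + q)"
  have w: "0 < w" using pos by (simp add: w_def)
  have "h powr \<rho> * h = h powr (\<rho> + 1)" using pos by (simp add: powr_add)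
  also have "\<dots> \<le> w" unfolding w_def using pos h1 by (intro powr_mono') auto
  finally have \<kappa>h: "\<kappa> * h \<le> L1 * w" using pos by (simp add: \<kappa>_def mult.assoc)
  have "h * sqrt N = sqrt h * (sqrt h * sqrt N)" using pos by (simp flip: mult.assoc)
  also have "\<dots> = sqrt h * sqrt T" by (simp add: real_sqrt_mult flip: hN)
  finally have "\<kappa> * h * sqrt N = L1 * (h powr \<rho> * sqrt h) * sqrt T" by (simp add: \<kappa>_def)
  also have "h powr \<rho> * sqrt h = w" using pos by (simp add: w_def powr_add powr_half_sqrt)
  finally have \<kappa>N: "\<kappa> * h * sqrt N = L1 * sqrt T * w" by simp
  have "(w + \<delta>) * 1 \<le> H" unfolding H_def using pos w by (intro mult_left_mono) auto
  then have "w + \<delta> \<le> H" by simp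
  with w pos have H: "\<delta> \<le> H" "w \<le> H" "0 < H" by simp_all
  have "w * q \<le> (w + \<delta>) * (1 + q)" using w pos by (intro mult_mono) auto
  then have "L1 * sqrt T * (w * q) \<le> L1 * sqrt T * H"
    unfolding H_def using pos by (intro mult_left_mono) auto
  then have 2: "\<kappa> * h * sqrt N * q \<le> L1 * sqrt T * H" unfolding \<kappa>N by (simp only: mult.assoc)
  have "L1 * w \<le> L1 * H" using H pos by (intro mult_left_mono) auto
  with \<kappa>h have k: "\<kappa> * h \<le> L1 * H" by linarith
  have "h * \<delta> \<le> 1 * H" using H pos h1 by (intro mult_mono) auto
  then have "L * (\<kappa> * h + h * \<delta>) \<le> L * (L1 * H + H)"
    using k pos by (intro mult_left_mono) auto
  from mult_left_mono[OF add_mono[OF this H(1)], of T]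
  have "T * (L * (\<kappa> * h + h * \<delta>) + \<delta>) \<le> T * (L * (L1 * H + H) + H)"
    using pos by simp
  also have "\<dots> = T * (L * L1 + L + 1) * H" by (simp add: algebra_simps)
  finally have 3: "\<delta> + \<kappa> * h * sqrt N * q + T * (L * (\<kappa> * h + h * \<delta>) + \<delta>)
      \<le> (1 + L1 * sqrt T + T * (L * L1 + L + 1)) * H"
    using 2 H unfolding distrib_right by linarith
  have "h * L \<le> 1 * L" using h1 pos by (intro mult_right_mono) auto
  then have "T * L * (1 + h * L) \<le> T * L * (1 + L)" using pos by (intro mult_left_mono) auto
  then have e: "exp (T * L * (1 + h * L)) \<le> exp (T * L * (1 + L))" by simp
  have "0 \<le> (1 + L1 * sqrt T + T * (L * L1 + L + 1)) * H" using pos H by simp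
  then have "(\<delta> + \<kappa> * h * sqrt N * q + T * (L * (\<kappa> * h + h * \<delta>) + \<delta>)) * exp (T * L * (1 + h * L))
      \<le> ((1 + L1 * sqrt T + T * (L * L1 + L + 1)) * H) * exp (T * L * (1 + L))"
    by (intro mult_mono 3 e) auto
  moreover have "2 * \<kappa> * h \<le> 2 * L1 * H" using k by simp
  moreover have "x * H * e + y * H = (x * e + y) * (w + \<delta>) * (1 + q)" for x y e
    by (simp add: H_def algebra_simps)
  ultimately show ?thesis
    unfolding w_def[symmetric] by (metis add_mono)
qed

text \<open>The main estimate with an explicit constant, valid for every exponent \<open>p > 0\<close>. The pathwise bound
  is applied with the partial sums bounded by \<open>\<kappa> * h * sqrt n * ln Q\<close>, where \<open>Q\<close> has a mean bounded in
  terms of the dimension alone.\<close>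

lemma rk2_Lp_error:
  fixes a b \<rho> K L p :: real and \<eta> :: "real ^ 'd" and M :: "'w measure"
  assumes "a < b" "0 < \<rho>" "\<rho> \<le> 1" "0 < K" "0 < L" "0 < p"
    and M: "prob_space M" "complete_measure M" and iid: "iid_uniform01 M \<tau>"
    and n: "0 < n" "(b - a) / real n \<le> 1" and \<delta>: "0 \<le> \<delta>" "\<delta> \<le> 1"
    and F: "(\<eta>, f) \<in> Fclass a b \<rho> K L" and noisy: "(\<eta>', f') \<in> noisy_data a b \<eta> f \<delta>"
    and z: "solves_ivp a b \<eta> f z"
  defines "h \<equiv> (b - a) / real n"
    and "X \<equiv> \<lambda>\<omega>. sup_error a b z (rk2_interp a b n \<eta>' f' (\<lambda>j. \<tau> j \<omega>))"
    and "L1 \<equiv> L * (1 + K * ((1 + K) * exp (K * (b - a))))"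
  defines "C \<equiv> (1 + L1 * sqrt (b - a) + (b - a) * (L * L1 + L + 1)) * exp ((b - a) * L * (1 + L)) + 2 * L1"
  shows "X \<in> borel_measurable M" "integrable M (\<lambda>\<omega>. \<bar>X \<omega>\<bar> powr p)"
    "Lp_norm M p X \<le> (p powr p * exp 1 * (8 * real CARD('d) * exp ((real CARD('d))\<^sup>2 / 2))) powr (1 / p)
      * (C * (h powr (\<rho> + 1 / 2) + \<delta>))"
proof -
  interpret prob_space M by fact
  interpret complete_measure M by fact
  define \<kappa> where "\<kappa> = L1 * h powr \<rho>"
  interpret P: perturbed_ivp a b L \<delta> \<kappa> n "l1ball \<eta> (Rbar a b K)" \<eta> \<eta>' f f' z
    unfolding \<kappa>_def L1_def h_def by (rule perturbed_ivp_Fclass[OF assms(1-5) \<delta>(1) F noisy z n])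
  have Ph: "P.h = h" by (simp add: P.h_def h_def)
  have h: "0 < h" "h \<le> 1" using P.step_size n by (auto simp: Ph h_def)
  have L1: "0 < L1" using assms(4,5) by (simp add: L1_def add_pos_pos)
  have \<kappa>: "0 < \<kappa>" using L1 h by (simp add: \<kappa>_def)
  have cont: "continuous_on ({a..b} \<times> UNIV) (\<lambda>(t, x). f t x)"
    and \<eta>: "l1norm \<eta> \<le> K" and growth: "\<And>t x. t \<in> {a..b} \<Longrightarrow> l1norm (f t x) \<le> K * (1 + l1norm x)"
    using F by (auto simp: Fclass_def)
  have contz: "continuous_on {a..b} (\<lambda>t. f t (z t))"
    using continuous_on_compose2[OF cont, of "{a..b}" "\<lambda>t. (t, z t)"]
      continuous_on_Pair[OF continuous_on_id P.continuous_z] by auto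
  have growth': "l1norm (f' t x) \<le> K * (1 + l1norm x) + 1" if "t \<in> {a..b}" for t x
    using P.noise[OF that, of x] growth[OF that, of x] l1norm_diff[of "f t x" "f t x - f' t x"] \<delta> by simp
  have \<eta>': "l1norm \<eta>' \<le> K + 1"
    using P.noise_init \<eta> l1norm_diff[of \<eta> "\<eta> - \<eta>'"] \<delta> by simp
  have \<tau>: "\<tau> j \<in> borel_measurable M" "distr M borel (\<tau> j) = uniform_measure lborel {0..1}" if "1 \<le> j" for j
    using iid that by (auto simp: iid_uniform01_def indep_vars_def)
  have AE01: "AE \<omega> in M. \<forall>j. 1 \<le> j \<longrightarrow> \<tau> j \<omega> \<in> {0..1}"
    using AE_uniform01[OF \<tau>(2) \<tau>(1)] by (subst AE_all_countable) (auto simp: AE_conj_iff)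

  obtain G where G: "(\<lambda>(t, x). G t x) \<in> borel_measurable borel" "\<And>t x. t \<in> {a..b} \<Longrightarrow> G t x = f' t x"
    using noisy_data_borel_extension[OF cont noisy] by blast
  show X: "X \<in> borel_measurable M"
  proof (rule borel_measurable_AE_eq)
    show "(\<lambda>\<omega>. sup_error a b z (rk2_interp a b n \<eta>' G (\<lambda>j. \<tau> j \<omega>))) \<in> borel_measurable M"
      by (rule borel_measurable_sup_error[OF assms(1) n(1) G(1) \<tau>(1) P.continuous_z])
    show "AE \<omega> in M. sup_error a b z (rk2_interp a b n \<eta>' G (\<lambda>j. \<tau> j \<omega>)) = X \<omega>"
      using AE01
    proof eventually_elim
      case (elim \<omega>)
      have "rk2_interp a b n \<eta>' G (\<lambda>j. \<tau> j \<omega>) t = rk2_interp a b n \<eta>' f' (\<lambda>j. \<tau> j \<omega>) t" if "t \<in> {a..b}" for t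
        using elim by (intro rk2_interp_cong assms(1) n G(2) that) auto
      then show ?case by (simp add: X_def sup_error_def)
    qed
  qed

  obtain Q where Q: "integrable M Q" "expectation Q \<le> 8 * real CARD('d) * exp ((real CARD('d))\<^sup>2 / 2)"
    and Q_ge: "\<And>\<omega> j. j \<le> n \<Longrightarrow>
      exp (l1norm (\<Sum>i<j. P.quad_err (\<lambda>i. clamp01 (\<tau> i \<omega>)) i) / (\<kappa> * h * sqrt n)) \<le> Q \<omega>"
    using P.quad_err_maximal_inequality[OF M(1) iid contz \<kappa>] unfolding Ph by blast
  have Q1: "1 \<le> Q \<omega>" for \<omega> using Q_ge[of 0 \<omega>] by simp
  define H where "H = C * (h powr (\<rho> + 1 / 2) + \<delta>)"
  have "0 < C" using L1 assms(1,5) by (auto simp: C_def intro!: add_pos_pos mult_pos_pos)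
  then have H: "0 < H" using h \<delta> by (simp add: H_def add_pos_nonneg)
  have bd: "AE \<omega> in M. \<bar>X \<omega>\<bar> \<le> H * (1 + ln (Q \<omega>))"
    using AE01
  proof eventually_elim
    case (elim \<omega>)
    define s where "s j = \<tau> j \<omega>" for j
    have s_eq: "s = (\<lambda>j. \<tau> j \<omega>)" by (simp add: s_def fun_eq_iff)
    define m where "m = \<kappa> * h * sqrt n * ln (Q \<omega>)"
    have s: "s j \<in> {0..1}" if "1 \<le> j" "j \<le> n" for j using elim that by (simp add: s_def)
    have V: "rk2 a b n \<eta>' f' s j \<in> l1ball \<eta> (Rbar a b K)"
      and W: "rk2_stage a b n \<eta>' f' s j \<in> l1ball \<eta> (Rbar a b K)" if "j < n" for j
      using rk2_in_l1ball[of a b K n s f' \<eta> \<eta>' j] assms(1,4) s growth' \<eta> \<eta>' that by auto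
    have m: "l1norm (\<Sum>i<j. P.quad_err s i) \<le> m" if j: "j \<le> n" for j
    proof -
      have "(\<Sum>i<j. P.quad_err s i) = (\<Sum>i<j. P.quad_err (\<lambda>i. clamp01 (\<tau> i \<omega>)) i)"
        using elim by (intro sum.cong) (auto simp: P.quad_err_def s_def clamp01_id)
      then have "l1norm (\<Sum>i<j. P.quad_err s i) / (\<kappa> * h * sqrt n) \<le> ln (Q \<omega>)"
        using Q_ge[OF j, of \<omega>] Q1[of \<omega>] by (simp add: ln_ge_iff)
      then show ?thesis using \<kappa> h n by (simp add: m_def pos_divide_le_eq mult.commute)
    qed
    have "0 \<le> X \<omega>" and "X \<omega> \<le> (\<delta> + m + (b - a) * (L * (\<kappa> * h + h * \<delta>) + \<delta>)) * exp ((b - a) * L * (1 + h * L)) + 2 * \<kappa> * h"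
      using P.sup_error_bound[of s m] s V W m by (auto simp: X_def Ph simp flip: s_eq)
    moreover have "\<dots> \<le> C * (h powr (\<rho> + 1 / 2) + \<delta>) * (1 + ln (Q \<omega>))"
      unfolding m_def \<kappa>_def C_def using assms(1,2,5) L1 h \<delta> Q1[of \<omega>] n
      by (intro error_terms_le) (auto simp: h_def)
    ultimately show ?case by (simp add: H_def)
  qed
  show "integrable M (\<lambda>\<omega>. \<bar>X \<omega>\<bar> powr p)"
    by (rule Lp_norm_le_of_log_bound(1)[OF X assms(6) H Q Q1 bd])
  show "Lp_norm M p X \<le> (p powr p * exp 1 * (8 * real CARD('d) * exp ((real CARD('d))\<^sup>2 / 2))) powr (1 / p)
      * (C * (h powr (\<rho> + 1 / 2) + \<delta>))"
    unfolding H_def[symmetric] by (rule Lp_norm_le_of_log_bound(2)[OF X assms(6) H Q Q1 bd])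
qed

theorem theorem1:
  fixes a b \<rho> K L p :: real
  assumes "a < b" and "0 < \<rho>" and "\<rho> \<le> 1" and "0 < K" and "0 < L" and "2 \<le> p"
  shows "\<exists>C>0. \<forall>(M :: 'w measure) \<tau>.
    prob_space M \<longrightarrow> complete_measure M \<longrightarrow> iid_uniform01 M \<tau> \<longrightarrow>
    (\<forall>n::nat. int n \<ge> \<lfloor>b - a\<rfloor> + 1 \<longrightarrow>
     (\<forall>\<delta>\<in>{0..1}. \<forall>(\<eta> :: real ^ 'd, f)\<in>Fclass a b \<rho> K L.
      \<forall>(\<eta>', f')\<in>noisy_data a b \<eta> f \<delta>. \<forall>z. solves_ivp a b \<eta> f z \<longrightarrow>
       (let h = (b - a) / real n;
            X = (\<lambda>\<omega>. sup_error a b z (rk2_interp a b n \<eta>' f' (\<lambda>j. \<tau> j \<omega>)))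
        in X \<in> borel_measurable M \<and>
           integrable M (\<lambda>\<omega>. \<bar>X \<omega>\<bar> powr p) \<and>
           Lp_norm M p X \<le> C * (h powr (\<rho> + 1 / 2) + \<delta>))))"
proof -
  define L1 where "L1 = L * (1 + K * ((1 + K) * exp (K * (b - a))))"
  define C1 where "C1 = (1 + L1 * sqrt (b - a) + (b - a) * (L * L1 + L + 1)) * exp ((b - a) * L * (1 + L)) + 2 * L1"
  define A where "A = (p powr p * exp 1 * (8 * real CARD('d) * exp ((real CARD('d))\<^sup>2 / 2))) powr (1 / p)"
  have "0 < L1" using assms by (simp add: L1_def add_pos_pos)
  then have "0 < C1" using assms by (auto simp: C1_def intro!: add_pos_pos mult_pos_pos)
  then have "0 < A * C1" using assms by (simp add: A_def)
  moreover have "X \<in> borel_measurable M \<and> integrable M (\<lambda>\<omega>. \<bar>X \<omega>\<bar> powr p) \<and>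
      Lp_norm M p X \<le> A * C1 * (((b - a) / real n) powr (\<rho> + 1 / 2) + \<delta>)"
    if M: "prob_space M" "complete_measure M" "iid_uniform01 M \<tau>"
      and n: "int n \<ge> \<lfloor>b - a\<rfloor> + 1" and \<delta>: "\<delta> \<in> {0..1}"
      and data: "(\<eta>, f) \<in> Fclass a b \<rho> K L" "(\<eta>', f') \<in> noisy_data a b \<eta> f \<delta>" "solves_ivp a b \<eta> f z"
      and X: "X = (\<lambda>\<omega>. sup_error a b z (rk2_interp a b n \<eta>' f' (\<lambda>j. \<tau> j \<omega>)))"
    for M :: "'w measure" and \<tau> n \<delta> and \<eta> \<eta>' :: "real ^ 'd" and f f' z X
  proof -
    have "b - a < real n" using n by linarith
    then have n': "0 < n" "(b - a) / real n \<le> 1" using assms(1) by (auto simp: divide_le_eq_1)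
    show ?thesis
      using rk2_Lp_error[OF assms(1-5) _ M n' _ _ data, of p] assms(6) \<delta>
      unfolding X A_def C1_def L1_def by (auto simp: mult.assoc)
  qed
  ultimately show ?thesis unfolding Let_def by (intro exI[of _ "A * C1"]) blast
qed

end
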